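(* Let $K$ be a transition kernel on $(G,\mathcal{B}(G))$ with stationary distribution $\pi$ (not necessarily reversible), let $\nu$ be a probability measure on $(G,\mathcal{B}(G))$, and consider the Markov chain with transition kernel $K$ and initial distribution $\nu$. Assume $\mathrm{gap}(P)>0$ and that $\nu$ has a density $\frac{d\nu}{d\pi}$ with respect to $\pi$ with $\left\|\frac{d\nu}{d\pi}\right\|_\infty<\infty$. Let $\delta\in(0,1]$, $p\in(1+\delta,2]$ and let $n_0\in\mathbb{N}_0$ satisfy $$n_0\ \ge\ \frac{\log\left(64\,\delta^{-1}\left\|\frac{d\nu}{d\pi}-1\right\|_\infty\right)}{\delta\cdot\mathrm{gap}(P)}.$$ Then for every $n\in\mathbb{N}$ and every $f\colon G\to\mathbb{R}$ with $\|f\|_p<\infty$, $$e_1(S_{n,n_0},f)\ \le\ \frac{8\|f\|_p}{(n\cdot\mathrm{gap}(P))^{1-\frac{1+\delta}{p}}}+\frac{8\|f\|_p}{(n\cdot\mathrm{gap}(P))^{2-\frac{2(1+\delta)}{p}}}.$$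
   Context: $G$ is a metric space with Borel $\sigma$-algebra $\mathcal{B}(G)$, $\pi$ is a probability measure on it, $\mathbb{N}=\{1,2,\dots\}$, $\mathbb{N}_0=\{0,1,2,\dots\}$. For $p\in[1,\infty]$, $L_p=L_p(\pi)$ is the space of measurable $f\colon G\to\mathbb{R}$ with $\|f\|_p<\infty$, where $\|f\|_p=(\int_G|f|^p\,d\pi)^{1/p}$ for $p<\infty$ and $\|f\|_\infty$ is the $\pi$-essential supremum of $|f|$. $\mathbb{E}_\pi(f)=\int_G f\,d\pi$; $\mathbb{E}_\pi$ is also regarded as the operator mapping $f$ to the constant function $\mathbb{E}_\pi(f)$. $\pi$ is stationary for $K$: $\int_G K(x,A)\,d\pi(x)=\pi(A)$ for all $A\in\mathcal{B}(G)$. The Markov operator is $Pf(x)=\int_G f(y)\,K(x,dy)$, and $\mathrm{gap}(P)=1-\|P-\mathbb{E}_\pi\|_{L_2\to L_2}$. Indexing of the chain: $X_0\sim\nu$, so $X_j$ has distribution $\nu P^j$ for $j\in\mathbb{N}$, where $\nu P(A)=\int_G K(x,A)\,d\nu(x)$. For $n\in\mathbb{N}$, $n_0\in\mathbb{N}_0$, $$S_{n,n_0}(f)=\frac1n\sum_{j=1}^n f(X_{j+n_0}),\qquad e_1(S_{n,n_0},f)=\mathbb{E}\left|S_{n,n_0}(f)-\mathbb{E}_\pi(f)\right|,$$ the expectation being over the trajectory of the chain. Convention: $\log 0=-\infty$ (so if $\nu=\pi$ every $n_0\in\mathbb{N}_0$ is admissible). *)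

theory Defs
  imports "HOL-Probability.Probability"
begin

text \<open>
  The state space is a type of class \<^class>\<open>metric_space\<close> with its Borel sigma-algebra
  \<open>borel\<close>. Probability measures on it are elements of \<open>space (prob_algebra borel)\<close>, transition
  kernels are elements of \<open>borel \<rightarrow>\<^sub>M prob_algebra borel\<close>.
\<close>

text \<open>
  The norm takes values in \<^typ>\<open>ennreal\<close>, so that \<open>Lp_norm p \<mu> f < \<infinity>\<close> carries its literal
  meaning (no default value is used for non-integrable functions).
\<close>

definition Lp_norm :: "ereal \<Rightarrow> 'a measure \<Rightarrow> ('a \<Rightarrow> real) \<Rightarrow> ennreal" where
  "Lp_norm p \<mu> f =
    (if p = \<infinity> then esssup \<mu> (\<lambda>x. ennreal \<bar>f x\<bar>)
     else let r = real_of_ereal p; I = (\<integral>\<^sup>+ x. ennreal (\<bar>f x\<bar> powr r) \<partial>\<mu>)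
          in if I = \<infinity> then \<infinity> else ennreal (enn2real I powr (1 / r)))"

definition Lp_space :: "ereal \<Rightarrow> 'a measure \<Rightarrow> ('a \<Rightarrow> real) set" where
  "Lp_space p \<mu> = {f \<in> borel_measurable \<mu>. Lp_norm p \<mu> f < \<infinity>}"

definition L2_op_norm :: "'a measure \<Rightarrow> (('a \<Rightarrow> real) \<Rightarrow> 'a \<Rightarrow> real) \<Rightarrow> ennreal" where
  "L2_op_norm \<mu> T = (SUP f \<in> {f \<in> Lp_space 2 \<mu>. Lp_norm 2 \<mu> f \<le> 1}. Lp_norm 2 \<mu> (T f))"

definition stationary :: "'a::metric_space measure \<Rightarrow> ('a \<Rightarrow> 'a measure) \<Rightarrow> bool" where
  "stationary \<pi> K \<longleftrightarrow> (\<forall>A \<in> sets borel. (\<integral>\<^sup>+ x. emeasure (K x) A \<partial>\<pi>) = emeasure \<pi> A)"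

text \<open>
  For \<open>f\<close> in \<open>L\<^sub>p(\<pi>)\<close> with \<open>\<pi>\<close> stationary, \<open>f\<close> is \<open>K x\<close>-integrable for \<open>\<pi>\<close>-almost every \<open>x\<close>;
  on the exceptional null set the integral below is \<open>0\<close>.
\<close>

definition markov_op :: "('a \<Rightarrow> 'a measure) \<Rightarrow> ('a \<Rightarrow> real) \<Rightarrow> 'a \<Rightarrow> real" where
  "markov_op K f x = (\<integral> y. f y \<partial>K x)"

text \<open>
  The conversion \<^const>\<open>enn2real\<close> would send \<open>\<infinity>\<close> to \<open>0\<close>; lemma \<open>L2_op_norm_le_1\<close> below shows
  that the operator norm is at most \<open>1\<close> for a stationary kernel, so nothing is lost.
\<close>

definition gap :: "'a measure \<Rightarrow> ('a \<Rightarrow> 'a measure) \<Rightarrow> real" where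
  "gap \<pi> K = 1 - enn2real (L2_op_norm \<pi> (\<lambda>f x. markov_op K f x - (\<integral> y. f y \<partial>\<pi>)))"

text \<open>The sigma-algebra on the sample space generated by \<open>X 0, \<dots>, X n\<close>.\<close>

definition past :: "'w measure \<Rightarrow> (nat \<Rightarrow> 'w \<Rightarrow> 'a::metric_space) \<Rightarrow> nat \<Rightarrow> 'w measure" where
  "past M X n =
    vimage_algebra (space M) (\<lambda>\<omega>. \<lambda>i\<in>{..n}. X i \<omega>) (\<Pi>\<^sub>M i\<in>{..n}. (borel :: 'a measure))"

text \<open>
  \<open>X\<close>, defined on the probability space \<open>M\<close>, is a Markov chain with transition kernel \<open>K\<close> and
  initial distribution \<open>\<nu>\<close>: the conditional probability of \<open>X (Suc n) \<in> A\<close> given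
  \<open>X 0, \<dots>, X n\<close> is \<open>K (X n) A\<close>.
\<close>

definition markov_chain ::
  "'w measure \<Rightarrow> (nat \<Rightarrow> 'w \<Rightarrow> 'a::metric_space) \<Rightarrow> ('a \<Rightarrow> 'a measure) \<Rightarrow> 'a measure \<Rightarrow> bool" where
  "markov_chain M X K \<nu> \<longleftrightarrow>
    prob_space M \<and>
    (\<forall>n. X n \<in> M \<rightarrow>\<^sub>M borel) \<and>
    distr M borel (X 0) = \<nu> \<and>
    (\<forall>n. \<forall>A \<in> sets borel. AE \<omega> in M.
       real_cond_exp M (past M X n) (\<lambda>\<omega>. indicator A (X (Suc n) \<omega>)) \<omega> = measure (K (X n \<omega>)) A)"

definition mcmc_average ::
  "(nat \<Rightarrow> 'w \<Rightarrow> 'a) \<Rightarrow> nat \<Rightarrow> nat \<Rightarrow> ('a \<Rightarrow> real) \<Rightarrow> 'w \<Rightarrow> real" where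
  "mcmc_average X n n0 f \<omega> = (1 / real n) * (\<Sum>j=1..n. f (X (j + n0) \<omega>))"

definition e1 ::
  "'w measure \<Rightarrow> (nat \<Rightarrow> 'w \<Rightarrow> 'a) \<Rightarrow> 'a measure \<Rightarrow> nat \<Rightarrow> nat \<Rightarrow> ('a \<Rightarrow> real) \<Rightarrow> ennreal" where
  "e1 M X \<pi> n n0 f = (\<integral>\<^sup>+ \<omega>. ennreal \<bar>mcmc_average X n n0 f \<omega> - (\<integral> x. f x \<partial>\<pi>)\<bar> \<partial>M)"

text \<open>Logarithm with the convention \<open>log 0 = -\<infinity>\<close>, in contrast to \<open>ln 0 = 0\<close>.\<close>

definition elog :: "ennreal \<Rightarrow> ereal" where
  "elog x = (if x = 0 then -\<infinity> else if x = \<infinity> then \<infinity> else ereal (ln (enn2real x)))"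

lemma L2_norm_le_iff:
  assumes "0 \<le> c"
  shows "Lp_norm 2 \<mu> f \<le> ennreal c \<longleftrightarrow> (\<integral>\<^sup>+ x. ennreal ((f x)\<^sup>2) \<partial>\<mu>) \<le> ennreal (c\<^sup>2)"
proof -
  have two: "real_of_ereal 2 = 2" "(2::ereal) \<noteq> \<infinity>"
    by (auto simp: numeral_eq_ereal)
  have pw: "\<bar>y\<bar> powr 2 = y\<^sup>2" for y :: real
    by (cases "y = 0") (auto simp: powr_numeral)
  define I where "I = (\<integral>\<^sup>+ x. ennreal ((f x)\<^sup>2) \<partial>\<mu>)"
  have N: "Lp_norm 2 \<mu> f = (if I = \<infinity> then \<infinity> else ennreal (enn2real I powr (1 / 2)))"
    unfolding Lp_norm_def Let_def two pw I_def using two by simp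
  show ?thesis
  proof (cases I)
    case (real r)
    then have "Lp_norm 2 \<mu> f = ennreal (sqrt r)"
      using N by (simp add: powr_half_sqrt)
    then show ?thesis
      using assms real unfolding I_def[symmetric]
      by (simp add: real_sqrt_le_iff' real_le_lsqrt sqrt_le_D)
  qed (use N in \<open>auto simp: I_def[symmetric] top_unique\<close>)
qed

lemma L2_op_norm_le_1:
  fixes \<pi> :: "'a::metric_space measure"
  assumes \<pi>: "\<pi> \<in> space (prob_algebra borel)"
    and K: "K \<in> borel \<rightarrow>\<^sub>M prob_algebra borel"
    and stat: "stationary \<pi> K"
  shows "L2_op_norm \<pi> (\<lambda>f x. markov_op K f x - (\<integral> y. f y \<partial>\<pi>)) \<le> 1"
  unfolding L2_op_norm_def
proof (rule SUP_least)
  fix f assume "f \<in> {f \<in> Lp_space 2 \<pi>. Lp_norm 2 \<pi> f \<le> 1}"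
  then have f0: "f \<in> borel_measurable \<pi>" and nf: "Lp_norm 2 \<pi> f \<le> ennreal 1"
    by (auto simp: Lp_space_def)
  have s\<pi>: "sets \<pi> = sets borel" and "prob_space \<pi>"
    using \<pi> by (auto simp: space_prob_algebra)
  interpret prob_space \<pi> by fact
  have f[measurable]: "f \<in> borel_measurable borel"
    using f0 s\<pi> measurable_cong_sets by blast
  have Ks: "K \<in> \<pi> \<rightarrow>\<^sub>M subprob_algebra borel"
    using measurable_prob_algebraD[OF K] s\<pi> measurable_cong_sets by blast
  have Kx: "prob_space (K x)" "sets (K x) = sets borel" for x
    using measurable_space[OF K, of x] by (auto simp: space_prob_algebra)
  have ne: "space \<pi> \<noteq> {}" by (rule not_empty)
  have bnd: "\<pi> \<bind> K = \<pi>"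
  proof (rule measure_eqI)
    show s: "sets (\<pi> \<bind> K) = sets \<pi>"
      using sets_bind[OF _ ne, of K borel] Kx s\<pi> by auto
    fix A assume "A \<in> sets (\<pi> \<bind> K)"
    then have "A \<in> sets borel" using s s\<pi> by auto
    then show "emeasure (\<pi> \<bind> K) A = emeasure \<pi> A"
      using stat by (simp add: emeasure_bind[OF ne Ks] stationary_def)
  qed
  define m where "m = (\<integral> y. f y \<partial>\<pi>)"
  have nf2: "(\<integral>\<^sup>+ x. ennreal ((f x)\<^sup>2) \<partial>\<pi>) \<le> 1"
    using nf by (subst (asm) L2_norm_le_iff) auto
  then have "(\<integral>\<^sup>+ x. ennreal ((f x)\<^sup>2) \<partial>\<pi>) < \<infinity>"
    by (rule le_less_trans) simp
  then have i2: "integrable \<pi> (\<lambda>x. (f x)\<^sup>2)"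
    using f0 by (intro integrableI_bounded) auto
  then have i1: "integrable \<pi> f"
    using f0 by (rule square_integrable_imp_integrable[rotated])
  have pt: "ennreal ((markov_op K f x - m)\<^sup>2) \<le> (\<integral>\<^sup>+ y. ennreal ((f y - m)\<^sup>2) \<partial>K x)" for x
  proof (cases "(\<integral>\<^sup>+ y. ennreal ((f y - m)\<^sup>2) \<partial>K x) = \<infinity>")
    case False
    interpret Kx: prob_space "K x" by (rule Kx)
    have fx: "f \<in> borel_measurable (K x)"
      using f Kx(2) measurable_cong_sets by blast
    have j2: "integrable (K x) (\<lambda>y. (f y - m)\<^sup>2)"
      using False fx by (intro integrableI_bounded) (auto simp: top.not_eq_extremum)
    have j1: "integrable (K x) (\<lambda>y. f y - m)"
      by (rule Kx.square_integrable_imp_integrable[OF _ j2]) (use fx in measurable)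
    then have jf: "integrable (K x) f"
      using Bochner_Integration.integrable_add[OF j1 Kx.integrable_const[of m]] by simp
    have "markov_op K f x - m = (\<integral> y. f y - m \<partial>K x)"
      using jf by (simp add: markov_op_def Kx.prob_space)
    moreover have "(\<integral> y. f y - m \<partial>K x)\<^sup>2 \<le> (\<integral> y. (f y - m)\<^sup>2 \<partial>K x)"
      using Kx.variance_eq[OF j1 j2] Kx.variance_positive[of "\<lambda>y. f y - m"] by simp
    ultimately show ?thesis
      using j2 by (simp add: nn_integral_eq_integral)
  qed simp
  have "(\<integral>\<^sup>+ x. ennreal ((markov_op K f x - m)\<^sup>2) \<partial>\<pi>)
      \<le> (\<integral>\<^sup>+ x. \<integral>\<^sup>+ y. ennreal ((f y - m)\<^sup>2) \<partial>K x \<partial>\<pi>)"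
    by (intro nn_integral_mono pt)
  also have "\<dots> = (\<integral>\<^sup>+ y. ennreal ((f y - m)\<^sup>2) \<partial>(\<pi> \<bind> K))"
    by (rule nn_integral_bind[symmetric, OF _ Ks]) measurable
  also have "\<dots> = ennreal (\<integral> y. (f y - m)\<^sup>2 \<partial>\<pi>)"
    unfolding bnd
  proof (rule nn_integral_eq_integral)
    show "integrable \<pi> (\<lambda>y. (f y - m)\<^sup>2)"
      using i1 i2 by (auto simp: power2_diff)
  qed simp
  also have "(\<integral> y. (f y - m)\<^sup>2 \<partial>\<pi>) = (\<integral> y. (f y)\<^sup>2 \<partial>\<pi>) - m\<^sup>2"
    unfolding m_def by (rule variance_eq[OF i1 i2])
  also have "ennreal \<dots> \<le> ennreal (\<integral> y. (f y)\<^sup>2 \<partial>\<pi>)"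
    by (intro ennreal_leI) simp
  also have "\<dots> = (\<integral>\<^sup>+ x. ennreal ((f x)\<^sup>2) \<partial>\<pi>)"
    using i2 by (simp add: nn_integral_eq_integral)
  also note nf2
  finally show "Lp_norm 2 \<pi> (\<lambda>x. markov_op K f x - (\<integral> y. f y \<partial>\<pi>)) \<le> 1"
    using L2_norm_le_iff[of 1 \<pi> "\<lambda>x. markov_op K f x - m"] by (simp add: m_def)
qed

end

theory Submission
  imports Defs
begin

text \<open>
  By homogeneity let \<open>\<parallel>f\<parallel>\<^sub>p \<le> 1\<close>, and put \<open>N = n \<cdot> gap\<close> and \<open>H = \<parallel>h - 1\<parallel>\<^sub>\<infinity>\<close>. If \<open>N \<ge> 1\<close>,
  truncate \<open>f = g + b\<close> at the level \<open>T = N powr (1 / p)\<close>. For the bounded part \<open>g\<close> the covariances decay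
  geometrically by the spectral gap, and the deviation of the law of \<open>X i\<close> from \<open>\<pi>\<close> costs a further
  term of order \<open>H exp (- gap n0) / N\<^sup>2\<close>, so the mean square error is of order \<open>N powr (2 / p - 2)\<close>.
  The remainder \<open>b\<close> has \<open>L\<^sub>1\<close> norm at most \<open>T powr (1 - p) = N powr (1 / p - 1)\<close>, and the non-stationarity
  adds at most \<open>2 H exp (- \<delta> gap i)\<close> to the expectation of \<open>\<bar>b\<bar>\<close> at time \<open>i\<close>; averaged over
  \<open>i\<close>, the burn-in condition turns this into \<open>O(1 / N)\<close>. If \<open>N < 1\<close>, the \<open>L\<^sub>1\<close> bound
  suffices. This gives the rate \<open>N powr (1 / p - 1)\<close> for \<open>N \<ge> 1\<close>, so the first summand of the bound is
  already enough.
\<close>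

section \<open>Bounded functions on finite measure spaces\<close>

lemma (in finite_measure) integrable_bounded_borel:
  assumes "sets M = sets N" "\<phi> \<in> borel_measurable N" "\<And>x. \<bar>\<phi> x\<bar> \<le> (B::real)"
  shows "integrable M \<phi>"
proof (rule integrable_const_bound[of _ B])
  show "\<phi> \<in> borel_measurable M"
    using assms(1,2) measurable_cong_sets by blast
qed (use assms(3) in simp)

text \<open>This is nonnegativity of the variance of \<open>\<bar>\<phi> x\<bar>\<close>;
  boundedness secures integrability.\<close>

lemma (in prob_space) abs_integral_le_sqrt:
  fixes \<phi> :: "'a \<Rightarrow> real"
  assumes [measurable]: "\<phi> \<in> borel_measurable M" and B: "\<And>x. \<bar>\<phi> x\<bar> \<le> B"
  shows "(\<integral>x. \<bar>\<phi> x\<bar> \<partial>M) \<le> sqrt (\<integral>x. (\<phi> x)\<^sup>2 \<partial>M)"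
proof (rule real_le_rsqrt)
  have B2: "\<bar>(\<phi> x)\<^sup>2\<bar> \<le> B\<^sup>2" for x
    using power_mono[OF B[of x], of 2] by simp
  have i: "integrable M (\<lambda>x. \<bar>\<phi> x\<bar>)" "integrable M (\<lambda>x. \<bar>\<phi> x\<bar>\<^sup>2)"
    using B B2 by (auto intro!: integrable_bounded_borel[OF refl])
  show "(\<integral>x. \<bar>\<phi> x\<bar> \<partial>M)\<^sup>2 \<le> (\<integral>x. (\<phi> x)\<^sup>2 \<partial>M)"
    using variance_eq[OF i] variance_positive[of "\<lambda>x. \<bar>\<phi> x\<bar>"] by simp
qed

section \<open>The Markov operator on bounded functions and its contraction in L2\<close>

locale stationary_kernel =
  fixes \<pi> :: "'a::metric_space measure" and K :: "'a \<Rightarrow> 'a measure"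
  assumes pi: "\<pi> \<in> space (prob_algebra borel)"
    and K: "K \<in> borel \<rightarrow>\<^sub>M prob_algebra borel"
    and stationary: "stationary \<pi> K"
begin

lemma sets_pi [measurable_cong, simp]: "sets \<pi> = sets borel"
  using pi by (simp add: space_prob_algebra)

lemma space_pi [simp]: "space \<pi> = UNIV"
  using sets_eq_imp_space_eq[OF sets_pi] by simp

sublocale prob_space \<pi>
  using pi by (simp add: space_prob_algebra)

lemma measurable_K [measurable]: "K \<in> borel \<rightarrow>\<^sub>M subprob_algebra borel"
  using K by (rule measurable_prob_algebraD)

lemma prob_space_K: "prob_space (K x)" and sets_K [simp]: "sets (K x) = sets borel"
  using measurable_space[OF K, of x] by (auto simp: space_prob_algebra)

text \<open>Stationarity as an equation between measures lets an integral against
  \<open>\<pi>\<close> be unfolded into one step of \<open>K\<close> and folded back.\<close>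

lemma bind_eq_pi: "\<pi> \<bind> K = \<pi>"
proof (rule measure_eqI)
  show s: "sets (\<pi> \<bind> K) = sets \<pi>"
    using sets_bind'[OF pi K] by simp
  fix A assume "A \<in> sets (\<pi> \<bind> K)"
  then have "A \<in> sets borel" using s by simp
  then show "emeasure (\<pi> \<bind> K) A = emeasure \<pi> A"
    using stationary by (simp add: emeasure_bind_prob_algebra[OF pi K] stationary_def)
qed

lemma integrable_pi: "\<phi> \<in> borel_measurable borel \<Longrightarrow> (\<And>x. \<bar>\<phi> x\<bar> \<le> B) \<Longrightarrow> integrable \<pi> \<phi>"
  for \<phi> :: "'a \<Rightarrow> real"
  by (rule integrable_bounded_borel[OF sets_pi])

text \<open>\<open>N\<close> is an arbitrary finite measure because \<open>markov_property\<close>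
  applies the formula to the law of \<open>X n\<close> under the restriction of \<open>M\<close> to
  an event of the past.\<close>

lemma integral_bind_K:
  fixes \<phi> :: "'a \<Rightarrow> real"
  assumes "finite_measure N" "sets N = sets borel"
    and "\<phi> \<in> borel_measurable borel" "\<And>x. \<bar>\<phi> x\<bar> \<le> B"
  shows "(\<integral>x. \<phi> x \<partial>(N \<bind> K)) = (\<integral>x. markov_op K \<phi> x \<partial>N)"
proof -
  have "K \<in> N \<rightarrow>\<^sub>M subprob_algebra borel"
    using assms(2) measurable_K measurable_cong_sets by blast
  moreover have "emeasure (K x) (space (K x)) \<le> ennreal 1" for x
    using prob_space.emeasure_space_1[OF prob_space_K] by simp
  ultimately show ?thesis
    unfolding markov_op_def by (intro integral_bind[where B=B and B'=1]) (use assms in auto)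
qed

lemma measurable_markov_op [measurable]:
  "\<phi> \<in> borel_measurable borel \<Longrightarrow> markov_op K \<phi> \<in> borel_measurable borel"
  unfolding markov_op_def
  by (rule measurable_compose[OF measurable_K integral_measurable_subprob_algebra])

lemma markov_op_bound:
  assumes "\<phi> \<in> borel_measurable borel" "\<And>x. \<bar>\<phi> x\<bar> \<le> B"
  shows "\<bar>markov_op K \<phi> x\<bar> \<le> B"
proof -
  interpret Kx: prob_space "K x" by (rule prob_space_K)
  have "\<bar>markov_op K \<phi> x\<bar> \<le> (\<integral>y. \<bar>\<phi> y\<bar> \<partial>K x)"
    unfolding markov_op_def by (rule integral_abs_bound)
  also have "\<dots> \<le> (\<integral>y. B \<partial>K x)"
    using assms by (intro integral_mono Kx.integrable_bounded_borel[OF sets_K]) auto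
  also have "\<dots> = B" by (simp add: Kx.prob_space)
  finally show ?thesis .
qed

lemma measurable_markov_op_pow [measurable]:
  "\<phi> \<in> borel_measurable borel \<Longrightarrow> (markov_op K ^^ k) \<phi> \<in> borel_measurable borel"
  by (induction k) auto

lemma markov_op_pow_bound:
  assumes "\<phi> \<in> borel_measurable borel" "\<And>x. \<bar>\<phi> x\<bar> \<le> B"
  shows "\<bar>(markov_op K ^^ k) \<phi> x\<bar> \<le> B"
  using assms by (induction k arbitrary: x) (auto intro: markov_op_bound)

lemma integral_markov_op_pow:
  assumes "\<phi> \<in> borel_measurable borel" "\<And>x. \<bar>\<phi> x\<bar> \<le> B"
  shows "(\<integral>x. (markov_op K ^^ k) \<phi> x \<partial>\<pi>) = (\<integral>x. \<phi> x \<partial>\<pi>)"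
proof (induction k)
  case (Suc k)
  have "(\<integral>x. (markov_op K ^^ k) \<phi> x \<partial>(\<pi> \<bind> K)) = (\<integral>x. (markov_op K ^^ Suc k) \<phi> x \<partial>\<pi>)"
    using integral_bind_K[OF finite_measure_axioms sets_pi, of "(markov_op K ^^ k) \<phi>" B]
      markov_op_pow_bound[OF assms] assms(1) by simp
  then show ?case using Suc by (simp add: bind_eq_pi)
qed simp

lemma gap_le_1: "gap \<pi> K \<le> 1"
  by (simp add: gap_def)

lemma gap_nonneg: "0 \<le> gap \<pi> K"
proof -
  have "enn2real (L2_op_norm \<pi> (\<lambda>f x. markov_op K f x - (\<integral>y. f y \<partial>\<pi>))) \<le> 1"
    using enn2real_mono[OF L2_op_norm_le_1[OF pi K stationary]] by simp
  then show ?thesis by (simp add: gap_def)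
qed

text \<open>On functions of mean 0 the centred operator in the definition of \<open>gap\<close>
  coincides with the Markov operator, so its norm \<open>1 - gap \<pi> K\<close> is a contraction
  factor there.\<close>

lemma markov_op_contraction:
  fixes \<phi> :: "'a \<Rightarrow> real"
  assumes [measurable]: "\<phi> \<in> borel_measurable borel" and B: "\<And>x. \<bar>\<phi> x\<bar> \<le> B"
    and mean: "(\<integral>x. \<phi> x \<partial>\<pi>) = 0"
  shows "(\<integral>x. (markov_op K \<phi> x)\<^sup>2 \<partial>\<pi>) \<le> (1 - gap \<pi> K)\<^sup>2 * (\<integral>x. (\<phi> x)\<^sup>2 \<partial>\<pi>)"
proof (rule field_le_epsilon)
  \<comment> \<open>the slack \<open>e\<close> allows normalising \<open>\<phi>\<close> also when its norm is \<open>0\<close>\<close>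
  fix e :: real assume e: "e > 0"
  let ?T = "\<lambda>f x. markov_op K f x - (\<integral>y. f y \<partial>\<pi>)"
  define r where "r = 1 - gap \<pi> K"
  define I where "I = (\<integral>x. (\<phi> x)\<^sup>2 \<partial>\<pi>)"
  define c where "c = sqrt (I + e)"
  have sq: "integrable \<pi> (\<lambda>x. (\<psi> x)\<^sup>2)" if "\<psi> \<in> borel_measurable borel" "\<And>x. \<bar>\<psi> x\<bar> \<le> C"
    for \<psi> and C :: real
    using that(1) power_mono[OF that(2), where n=2] by (intro integrable_pi[of _ "C\<^sup>2"]) auto
  have "0 \<le> I" unfolding I_def by simp
  then have c: "c > 0" and c2: "c\<^sup>2 = I + e" using e by (auto simp: c_def)
  have r: "0 \<le> r" "r \<le> 1" using gap_le_1 gap_nonneg by (auto simp: r_def)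
  \<comment> \<open>\<open>gap\<close> passes through \<open>enn2real\<close>; the operator norm is
    recovered from it because the norm is at most 1 and hence finite.\<close>
  have op: "L2_op_norm \<pi> ?T = ennreal r"
    using L2_op_norm_le_1[OF pi K stationary] unfolding r_def gap_def
    by (simp add: top.not_eq_extremum order_le_less_trans)
  let ?\<psi> = "\<lambda>x. \<phi> x / c"
  have T: "?T ?\<psi> x = markov_op K \<phi> x / c" for x
    using mean by (simp add: markov_op_def)
  have "(\<integral>\<^sup>+ x. ennreal ((?\<psi> x)\<^sup>2) \<partial>\<pi>) = ennreal (\<integral>x. (?\<psi> x)\<^sup>2 \<partial>\<pi>)"
    using B c by (intro nn_integral_eq_integral sq[of _ "B / c"]) (auto simp: divide_right_mono)
  also have "(\<integral>x. (?\<psi> x)\<^sup>2 \<partial>\<pi>) = I / c\<^sup>2"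
    by (simp add: power_divide I_def)
  also have "ennreal \<dots> \<le> ennreal (1\<^sup>2)"
    using c2 \<open>0 \<le> I\<close> e by (intro ennreal_leI) (simp add: divide_simps)
  finally have n1: "Lp_norm 2 \<pi> ?\<psi> \<le> 1"
    using L2_norm_le_iff[of 1 \<pi> ?\<psi>] by simp
  then have "?\<psi> \<in> Lp_space 2 \<pi>"
    by (auto simp: Lp_space_def order_le_less_trans[OF _ ennreal_one_less_top])
  then have "Lp_norm 2 \<pi> (?T ?\<psi>) \<le> ennreal r"
    using n1 unfolding op[symmetric] L2_op_norm_def by (intro SUP_upper2[of ?\<psi>]) auto
  then have "(\<integral>\<^sup>+ x. ennreal ((markov_op K \<phi> x / c)\<^sup>2) \<partial>\<pi>) \<le> ennreal (r\<^sup>2)"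
    using r unfolding T by (subst (asm) L2_norm_le_iff) auto
  also have "(\<integral>\<^sup>+ x. ennreal ((markov_op K \<phi> x / c)\<^sup>2) \<partial>\<pi>)
      = ennreal (\<integral>x. (markov_op K \<phi> x / c)\<^sup>2 \<partial>\<pi>)"
    using markov_op_bound[of \<phi> B] B c
    by (intro nn_integral_eq_integral sq[of _ "B / c"]) (auto simp: divide_right_mono)
  also have "(\<integral>x. (markov_op K \<phi> x / c)\<^sup>2 \<partial>\<pi>) = (\<integral>x. (markov_op K \<phi> x)\<^sup>2 \<partial>\<pi>) / c\<^sup>2"
    by (simp add: power_divide)
  finally have "(\<integral>x. (markov_op K \<phi> x)\<^sup>2 \<partial>\<pi>) \<le> r\<^sup>2 * (I + e)"
    using c r by (simp add: c2[symmetric] divide_simps split: if_splits)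
  also have "\<dots> \<le> r\<^sup>2 * I + 1 * e"
    unfolding distrib_left using r e by (intro add_left_mono mult_right_mono) (auto simp: power_le_one)
  finally show "(\<integral>x. (markov_op K \<phi> x)\<^sup>2 \<partial>\<pi>) \<le> (1 - gap \<pi> K)\<^sup>2 * (\<integral>x. (\<phi> x)\<^sup>2 \<partial>\<pi>) + e"
    by (simp add: r_def I_def)
qed

text \<open>The contraction iterates because the Markov operator preserves both the bound
  \<open>B\<close> and the mean. The factor \<open>1 - gap \<pi> K\<close> is relaxed to
  \<open>exp (- gap \<pi> K)\<close> so that times add up in the exponent.\<close>

lemma markov_op_pow_contraction:
  fixes \<phi> :: "'a \<Rightarrow> real"
  assumes \<phi>: "\<phi> \<in> borel_measurable borel" "\<And>x. \<bar>\<phi> x\<bar> \<le> B"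
    and mean: "(\<integral>x. \<phi> x \<partial>\<pi>) = 0"
  shows "(\<integral>x. ((markov_op K ^^ k) \<phi> x)\<^sup>2 \<partial>\<pi>) \<le> (exp (- gap \<pi> K * k))\<^sup>2 * (\<integral>x. (\<phi> x)\<^sup>2 \<partial>\<pi>)"
proof (induction k)
  case (Suc k)
  have r: "0 \<le> 1 - gap \<pi> K" "1 - gap \<pi> K \<le> exp (- gap \<pi> K)"
    using gap_le_1 exp_ge_add_one_self[of "- gap \<pi> K"] by auto
  have e: "exp (- gap \<pi> K * Suc k) = exp (- gap \<pi> K) * exp (- gap \<pi> K * k)"
    by (simp add: exp_add[symmetric] algebra_simps)
  have "(\<integral>x. ((markov_op K ^^ Suc k) \<phi> x)\<^sup>2 \<partial>\<pi>)
      \<le> (1 - gap \<pi> K)\<^sup>2 * (\<integral>x. ((markov_op K ^^ k) \<phi> x)\<^sup>2 \<partial>\<pi>)"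
    using markov_op_contraction[of "(markov_op K ^^ k) \<phi>" B]
      markov_op_pow_bound[OF \<phi>] \<phi>(1) integral_markov_op_pow[OF \<phi>] mean by simp
  also have "\<dots> \<le> (exp (- gap \<pi> K))\<^sup>2 * ((exp (- gap \<pi> K * k))\<^sup>2 * (\<integral>x. (\<phi> x)\<^sup>2 \<partial>\<pi>))"
    using r Suc by (intro mult_mono power_mono) auto
  also have "\<dots> = (exp (- gap \<pi> K * Suc k))\<^sup>2 * (\<integral>x. (\<phi> x)\<^sup>2 \<partial>\<pi>)"
    unfolding e by (simp add: power_mult_distrib)
  finally show ?case .
qed simp

end

section \<open>The Markov property, and the distance of the law of the chain from
  stationarity\<close>

locale stationary_kernel_chain = stationary_kernel +
  fixes M :: "'w measure" and X :: "nat \<Rightarrow> 'w \<Rightarrow> 'a" and \<nu> :: "'a measure"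
    and h :: "'a \<Rightarrow> real" and H :: real
  assumes chain: "markov_chain M X K \<nu>"
    and h [measurable]: "h \<in> borel_measurable borel" and h_nonneg: "AE x in \<pi>. 0 \<le> h x"
    and density: "\<nu> = density \<pi> (\<lambda>x. ennreal (h x))"
    and h_dist: "AE x in \<pi>. \<bar>h x - 1\<bar> \<le> H"
begin

sublocale M: prob_space M
  using chain by (simp add: markov_chain_def)

lemma measurable_X [measurable]: "X n \<in> M \<rightarrow>\<^sub>M borel"
  using chain by (simp add: markov_chain_def)

lemma subalgebra_past: "subalgebra M (past M X n)"
proof -
  have "sets (past M X n) \<subseteq> sets M"
    unfolding past_def by (rule sets_image_in_sets) measurable
  then show ?thesis by (simp add: subalgebra_def past_def)
qed

sublocale past: finite_measure_subalgebra M "past M X n" for n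
  by unfold_locales (rule subalgebra_past)

lemma measurable_X_past: "i \<le> n \<Longrightarrow> X i \<in> past M X n \<rightarrow>\<^sub>M borel"
proof -
  assume i: "i \<le> n"
  have "(\<lambda>\<omega>. \<lambda>i\<in>{..n}. X i \<omega>) \<in> past M X n \<rightarrow>\<^sub>M (\<Pi>\<^sub>M i\<in>{..n}. borel)"
    unfolding past_def
    by (rule measurable_vimage_algebra1) (auto simp: space_PiM)
  from measurable_compose[OF this measurable_component_singleton[of i]] i
  show ?thesis by (simp add: restrict_apply cong: measurable_cong)
qed

text \<open>Integrating the conditional probability over an event \<open>B\<close> of the past turns
  the definition of a Markov chain into an equation between measures. General \<open>B\<close> gives
  the Markov property for functions; \<open>B = space M\<close> gives the one-step evolution of the
  law.\<close>

lemma distr_X_Suc: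
  assumes B: "B \<in> sets (past M X n)"
  defines "N \<equiv> density M (\<lambda>\<omega>. ennreal (indicator B \<omega>))"
  shows "distr N borel (X (Suc n)) = distr N borel (X n) \<bind> K"
proof (rule measure_eqI)
  have BM [measurable]: "B \<in> sets M"
    using B subalgebra_past by (auto simp: subalgebra_def)
  have ne: "space (distr N borel (X n)) \<noteq> {}" by simp
  have Ks: "K \<in> distr N borel (X n) \<rightarrow>\<^sub>M subprob_algebra borel"
    by simp
  show s: "sets (distr N borel (X (Suc n))) = sets (distr N borel (X n) \<bind> K)"
    using sets_bind_measurable[OF Ks ne] by simp
  fix A assume "A \<in> sets (distr N borel (X (Suc n)))"
  then have A [measurable]: "A \<in> sets borel" by simp
  have cond: "AE \<omega> in M. real_cond_exp M (past M X n) (\<lambda>\<omega>. indicator A (X (Suc n) \<omega>)) \<omega>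
      = measure (K (X n \<omega>)) A"
    using chain A by (simp add: markov_chain_def)
  have mK [measurable]: "(\<lambda>x. measure (K x) A) \<in> borel_measurable borel"
    by (rule measurable_compose[OF K measurable_measure_prob_algebra]) measurable
  have int1: "integrable M (\<lambda>\<omega>. indicator A (X (Suc n) \<omega>) :: real)"
    by (rule M.integrable_const_bound[of _ 1]) auto
  have eq: "(\<integral>\<omega>. indicator B \<omega> * indicator A (X (Suc n) \<omega>) \<partial>M)
      = (\<integral>\<omega>. indicator B \<omega> * measure (K (X n \<omega>)) A \<partial>M)"
  proof -
    have "(\<integral>\<omega>. indicator B \<omega> * indicator A (X (Suc n) \<omega>) \<partial>M)
      = (\<integral>\<omega>. indicator B \<omega> *
           real_cond_exp M (past M X n) (\<lambda>\<omega>. indicator A (X (Suc n) \<omega>)) \<omega> \<partial>M)"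
      using past.real_cond_exp_intA[OF int1 B] by (simp add: set_lebesgue_integral_def)
    also have "\<dots> = (\<integral>\<omega>. indicator B \<omega> * measure (K (X n \<omega>)) A \<partial>M)"
      by (intro integral_cong_AE) (use cond in \<open>auto elim!: eventually_mono\<close>)
    finally show ?thesis .
  qed
  \<comment> \<open>The conditional expectation is real-valued, so the calculation goes from
    \<open>emeasure\<close> to a Bochner integral, applies \<open>eq\<close> there, and
    returns.\<close>
  have "emeasure (distr N borel (X (Suc n))) A
      = (\<integral>\<^sup>+x. indicator A x \<partial>distr N borel (X (Suc n)))"
    by simp
  also have "\<dots> = (\<integral>\<^sup>+\<omega>. indicator A (X (Suc n) \<omega>) \<partial>N)"
    unfolding N_def by (rule nn_integral_distr) auto
  also have "\<dots> = (\<integral>\<^sup>+\<omega>. ennreal (indicator B \<omega> * indicator A (X (Suc n) \<omega>)) \<partial>M)"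
    unfolding N_def
    by (subst nn_integral_density) (auto intro!: nn_integral_cong simp: ennreal_mult ennreal_indicator)
  also have "\<dots> = ennreal (\<integral>\<omega>. indicator B \<omega> * indicator A (X (Suc n) \<omega>) \<partial>M)"
    by (intro nn_integral_eq_integral M.integrable_const_bound[of _ 1]) (auto simp: indicator_def)
  also have "\<dots> = ennreal (\<integral>\<omega>. indicator B \<omega> * measure (K (X n \<omega>)) A \<partial>M)"
    by (simp only: eq)
  also have "\<dots> = (\<integral>\<^sup>+\<omega>. ennreal (indicator B \<omega> * measure (K (X n \<omega>)) A) \<partial>M)"
    by (intro nn_integral_eq_integral[symmetric] M.integrable_const_bound[of _ 1])
      (auto simp: indicator_def prob_space.prob_le_1[OF prob_space_K])
  also have "\<dots> = (\<integral>\<^sup>+\<omega>. emeasure (K (X n \<omega>)) A \<partial>N)"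
    unfolding N_def using finite_measure.emeasure_eq_measure[OF prob_space.finite_measure[OF prob_space_K]]
    by (subst nn_integral_density) (auto intro!: nn_integral_cong simp: ennreal_mult)
  also have "\<dots> = emeasure (distr N borel (X n) \<bind> K) A"
    using measurable_emeasure_subprob_algebra[OF A]
    by (subst emeasure_bind[OF ne Ks A]) (auto simp: N_def nn_integral_distr)
  finally show "emeasure (distr N borel (X (Suc n))) A = emeasure (distr N borel (X n) \<bind> K) A" .
qed

text \<open>The passage from indicators to bounded functions needs no approximation:
  \<open>\<phi>\<close> is integrated against the two equal measures of \<open>distr_X_Suc\<close>,
  for each event of the past.\<close>

lemma markov_property:
  fixes \<phi> :: "'a \<Rightarrow> real"
  assumes [measurable]: "\<phi> \<in> borel_measurable borel" and B: "\<And>x. \<bar>\<phi> x\<bar> \<le> C"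
  shows "AE \<omega> in M. real_cond_exp M (past M X n) (\<lambda>\<omega>. \<phi> (X (Suc n) \<omega>)) \<omega> = markov_op K \<phi> (X n \<omega>)"
proof (rule past.real_cond_exp_charact)
  fix A assume A: "A \<in> sets (past M X n)"
  have [measurable]: "A \<in> sets M"
    using A subalgebra_past by (auto simp: subalgebra_def)
  define N where "N = density M (\<lambda>\<omega>. ennreal (indicator A \<omega>))"
  have [measurable_cong]: "sets N = sets M" by (simp add: N_def)
  have N: "(\<integral>x. \<psi> (X i x) \<partial>N) = (\<integral>\<omega>\<in>A. \<psi> (X i \<omega>) \<partial>M)"
    if [measurable]: "\<psi> \<in> borel_measurable borel" for \<psi> :: "'a \<Rightarrow> real" and i
    unfolding N_def by (subst integral_density) (auto simp: set_lebesgue_integral_def)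
  have "finite_measure N"
    unfolding N_def ennreal_indicator
    by (rule finite_measureI) (simp add: emeasure_density ennreal_indicator M.emeasure_finite)
  then have "finite_measure (distr N borel (X n))"
    by (rule finite_measure.finite_measure_distr) measurable
  then have "(\<integral>x. \<phi> x \<partial>(distr N borel (X n) \<bind> K)) = (\<integral>x. markov_op K \<phi> x \<partial>(distr N borel (X n)))"
    by (rule integral_bind_K[where B=C]) (use B in auto)
  then show "(\<integral>\<omega>\<in>A. \<phi> (X (Suc n) \<omega>) \<partial>M) = (\<integral>\<omega>\<in>A. markov_op K \<phi> (X n \<omega>) \<partial>M)"
    unfolding distr_X_Suc[OF A, folded N_def, symmetric]
    by (simp add: integral_distr N)
next
  show "(\<lambda>\<omega>. markov_op K \<phi> (X n \<omega>)) \<in> borel_measurable (past M X n)"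
    by (rule measurable_compose[OF measurable_X_past]) auto
qed (use B markov_op_bound[of \<phi> C] in \<open>auto intro!: M.integrable_const_bound[of _ C]\<close>)

text \<open>Conditioning on the past up to time \<open>n + k\<close> removes the last step of the
  chain and replaces \<open>\<phi>\<close> by \<open>markov_op K \<phi>\<close>; the factor in
  \<open>X n\<close> is measurable with respect to that past and stays outside.\<close>

lemma expectation_markov_op_pow:
  fixes \<phi> \<psi> :: "'a \<Rightarrow> real"
  assumes \<psi> [measurable]: "\<psi> \<in> borel_measurable borel" and C: "\<And>x. \<bar>\<psi> x\<bar> \<le> C"
    and "\<phi> \<in> borel_measurable borel" "\<And>x. \<bar>\<phi> x\<bar> \<le> B"
  shows "(\<integral>\<omega>. \<psi> (X n \<omega>) * \<phi> (X (n + k) \<omega>) \<partial>M) = (\<integral>\<omega>. \<psi> (X n \<omega>) * (markov_op K ^^ k) \<phi> (X n \<omega>) \<partial>M)"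
  using assms(3,4)
proof (induction k arbitrary: \<phi>)
  case (Suc k)
  note [measurable] = Suc.prems(1)
  have "0 \<le> C" using C[of undefined] by simp
  have m: "(\<lambda>\<omega>. \<psi> (X n \<omega>)) \<in> borel_measurable (past M X (n + k))"
    by (rule measurable_compose[OF measurable_X_past]) auto
  have i: "integrable M (\<lambda>\<omega>. \<psi> (X n \<omega>) * \<phi> (X (Suc (n + k)) \<omega>))"
    using C Suc.prems(2) \<open>0 \<le> C\<close>
    by (intro M.integrable_const_bound[of _ "C * B"]) (auto simp: abs_mult intro!: mult_mono)
  have "(\<integral>\<omega>. \<psi> (X n \<omega>) * \<phi> (X (Suc (n + k)) \<omega>) \<partial>M)
    = (\<integral>\<omega>. \<psi> (X n \<omega>) * real_cond_exp M (past M X (n + k)) (\<lambda>\<omega>. \<phi> (X (Suc (n + k)) \<omega>)) \<omega> \<partial>M)"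
    using past.real_cond_exp_intg(2)[OF i m] by simp
  also have "\<dots> = (\<integral>\<omega>. \<psi> (X n \<omega>) * markov_op K \<phi> (X (n + k) \<omega>) \<partial>M)"
    using markov_property[OF Suc.prems, of "n + k"]
    by (intro integral_cong_AE) (auto elim!: eventually_mono)
  also have "\<dots> = (\<integral>\<omega>. \<psi> (X n \<omega>) * (markov_op K ^^ k) (markov_op K \<phi>) (X n \<omega>) \<partial>M)"
    using Suc.IH[of "markov_op K \<phi>"] markov_op_bound[OF Suc.prems] by simp
  finally show ?case by (simp add: funpow_swap1)
qed simp

lemma H_nonneg: "0 \<le> H"
proof -
  from h_dist have "AE x in \<pi>. 0 \<le> H"
    by (rule eventually_mono) linarith
  then show ?thesis by simp
qed

lemma distr_X_0: "distr M borel (X 0) = \<nu>"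
  using chain by (simp add: markov_chain_def)

text \<open>The initial law is at most \<open>1 + H\<close> times \<open>\<pi>\<close> because
  \<open>h \<le> 1 + H\<close> almost everywhere, and stationarity passes this domination on to
  every later time. It also covers unbounded functions, such as the part of \<open>f\<close> above a
  truncation level.\<close>

lemma nn_integral_X_le:
  "\<phi> \<in> borel_measurable borel \<Longrightarrow>
    (\<integral>\<^sup>+\<omega>. \<phi> (X n \<omega>) \<partial>M) \<le> ennreal (1 + H) * (\<integral>\<^sup>+x. \<phi> x \<partial>\<pi>)"
proof (induction n arbitrary: \<phi>)
  case 0
  note [measurable] = 0
  have "(\<integral>\<^sup>+\<omega>. \<phi> (X 0 \<omega>) \<partial>M) = (\<integral>\<^sup>+x. \<phi> x \<partial>\<nu>)"
    by (simp flip: distr_X_0 add: nn_integral_distr)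
  also have "\<dots> = (\<integral>\<^sup>+x. ennreal (h x) * \<phi> x \<partial>\<pi>)"
    unfolding density by (rule nn_integral_density) measurable
  also have "\<dots> \<le> (\<integral>\<^sup>+x. ennreal (1 + H) * \<phi> x \<partial>\<pi>)"
    by (intro nn_integral_mono_AE)
      (use h_dist in \<open>auto elim!: eventually_mono intro!: mult_right_mono ennreal_leI\<close>)
  also have "\<dots> = ennreal (1 + H) * (\<integral>\<^sup>+x. \<phi> x \<partial>\<pi>)"
    by (rule nn_integral_cmult) measurable
  finally show ?case .
next
  case (Suc n)
  note [measurable] = Suc.prems
  have P [measurable]: "(\<lambda>x. \<integral>\<^sup>+y. \<phi> y \<partial>K x) \<in> borel_measurable borel"
    by (rule measurable_compose[OF measurable_K nn_integral_measurable_subprob_algebra]) measurable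
  \<comment> \<open>The sure event belongs to every past, and restricting to it changes
    nothing.\<close>
  have d: "density M (\<lambda>\<omega>. ennreal (indicator (space M) \<omega>)) = M"
    by (simp add: density_cong[of _ M "\<lambda>_. 1"] density_1)
  have "space M \<in> sets (past M X n)"
    using subalgebra_past[of n] sets.top[of "past M X n"] by (simp add: subalgebra_def)
  from distr_X_Suc[OF this] have "distr M borel (X (Suc n)) = distr M borel (X n) \<bind> K"
    by (simp add: d)
  then have "(\<integral>\<^sup>+\<omega>. \<phi> (X (Suc n) \<omega>) \<partial>M) = (\<integral>\<^sup>+x. \<phi> x \<partial>(distr M borel (X n) \<bind> K))"
    by (simp add: nn_integral_distr flip: \<open>distr M borel (X (Suc n)) = _\<close>)
  also have "\<dots> = (\<integral>\<^sup>+x. \<integral>\<^sup>+y. \<phi> y \<partial>K x \<partial>distr M borel (X n))"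
    by (rule nn_integral_bind[where B=borel]) auto
  also have "\<dots> = (\<integral>\<^sup>+\<omega>. \<integral>\<^sup>+y. \<phi> y \<partial>K (X n \<omega>) \<partial>M)"
    by (rule nn_integral_distr) auto
  also have "\<dots> \<le> ennreal (1 + H) * (\<integral>\<^sup>+x. \<integral>\<^sup>+y. \<phi> y \<partial>K x \<partial>\<pi>)"
    by (rule Suc.IH) measurable
  also have "(\<integral>\<^sup>+x. \<integral>\<^sup>+y. \<phi> y \<partial>K x \<partial>\<pi>) = (\<integral>\<^sup>+x. \<phi> x \<partial>(\<pi> \<bind> K))"
    by (rule nn_integral_bind[where B=borel, symmetric]) measurable
  finally show ?case by (simp add: bind_eq_pi)
qed

text \<open>The expectation equals the \<open>\<pi>\<close>-integral of \<open>h - 1\<close> times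
  the \<open>n\<close>-th iterate of \<open>\<phi>\<close>. The first factor is bounded by
  \<open>H\<close>, and the L1 norm of the second by its L2 norm, which decays
  geometrically.\<close>

lemma abs_expectation_X_le:
  fixes \<phi> :: "'a \<Rightarrow> real"
  assumes \<phi>: "\<phi> \<in> borel_measurable borel" "\<And>x. \<bar>\<phi> x\<bar> \<le> B"
    and mean: "(\<integral>x. \<phi> x \<partial>\<pi>) = 0"
  shows "\<bar>\<integral>\<omega>. \<phi> (X n \<omega>) \<partial>M\<bar> \<le> H * exp (- gap \<pi> K * n) * sqrt (\<integral>x. (\<phi> x)\<^sup>2 \<partial>\<pi>)"
proof -
  note [measurable] = \<phi>(1)
  define \<psi> where "\<psi> = (markov_op K ^^ n) \<phi>"
  have [measurable]: "\<psi> \<in> borel_measurable borel" unfolding \<psi>_def by measurable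
  have \<psi>: "\<bar>\<psi> x\<bar> \<le> B" for x
    unfolding \<psi>_def by (rule markov_op_pow_bound[OF \<phi>])
  have i: "integrable \<pi> \<psi>" by (rule integrable_pi[OF _ \<psi>]) measurable
  have ih: "integrable \<pi> (\<lambda>x. h x * \<psi> x)"
    using h_dist \<psi> H_nonneg
    by (intro integrable_const_bound[of _ "(1 + H) * B"])
      (auto simp: abs_mult elim!: eventually_mono intro!: mult_mono)
  have "(\<integral>\<omega>. \<phi> (X n \<omega>) \<partial>M) = (\<integral>\<omega>. \<psi> (X 0 \<omega>) \<partial>M)"
    using expectation_markov_op_pow[of "\<lambda>_. 1" 1 \<phi> B 0 n] \<phi> by (simp add: \<psi>_def)
  also have "\<dots> = (\<integral>x. \<psi> x \<partial>\<nu>)"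
    by (simp flip: distr_X_0 add: integral_distr)
  also have "\<dots> = (\<integral>x. h x * \<psi> x \<partial>\<pi>)"
    unfolding density using h_nonneg by (subst integral_density) auto
  \<comment> \<open>The subtracted integral is 0; it turns the density into its deviation
    \<open>h - 1\<close> from stationarity.\<close>
  also have "\<dots> = (\<integral>x. h x * \<psi> x \<partial>\<pi>) - (\<integral>x. \<psi> x \<partial>\<pi>)"
    using integral_markov_op_pow[OF \<phi>, of n] mean by (simp add: \<psi>_def)
  also have "\<dots> = (\<integral>x. (h x - 1) * \<psi> x \<partial>\<pi>)"
    using i ih by (simp add: left_diff_distrib)
  finally have "\<bar>\<integral>\<omega>. \<phi> (X n \<omega>) \<partial>M\<bar> \<le> (\<integral>x. \<bar>(h x - 1) * \<psi> x\<bar> \<partial>\<pi>)"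
    by simp
  also have "\<dots> \<le> (\<integral>x. H * \<bar>\<psi> x\<bar> \<partial>\<pi>)"
  proof (rule integral_mono_AE)
    show "AE x in \<pi>. \<bar>(h x - 1) * \<psi> x\<bar> \<le> H * \<bar>\<psi> x\<bar>"
      using h_dist by (rule eventually_mono) (simp add: abs_mult mult_right_mono)
  qed (use i ih in \<open>auto simp: left_diff_distrib intro!: integrable_abs\<close>)
  also have "\<dots> \<le> H * sqrt (\<integral>x. (\<psi> x)\<^sup>2 \<partial>\<pi>)"
    using abs_integral_le_sqrt[of \<psi> B] \<psi> H_nonneg by (simp add: mult_left_mono)
  also have "\<dots> \<le> H * sqrt ((exp (- gap \<pi> K * n))\<^sup>2 * (\<integral>x. (\<phi> x)\<^sup>2 \<partial>\<pi>))"
    unfolding \<psi>_def using H_nonneg markov_op_pow_contraction[OF \<phi> mean, of n]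
    by (intro mult_left_mono real_sqrt_le_mono)
  finally show ?thesis by (simp add: real_sqrt_mult)
qed

end

section \<open>Exponential sums\<close>

lemma sum_exp_le:
  fixes x :: real and n :: nat
  assumes "0 < x"
  shows "(\<Sum>j=1..n. exp (- x * real j)) \<le> 1 / x"
proof -
  \<comment> \<open>This sharper bound is inductive: its increments telescope, and
    \<open>1 + x \<le> exp x\<close> compares them with the new term.\<close>
  have "(\<Sum>j=1..n. exp (- x * real j)) \<le> (1 - exp (- x * n)) / x"
  proof (induction n)
    case (Suc n)
    have "exp (- x * n) = exp x * exp (- x * Suc n)"
      by (simp add: exp_add[symmetric] algebra_simps)
    also have "\<dots> \<ge> (1 + x) * exp (- x * Suc n)"
      by (intro mult_right_mono exp_ge_add_one_self) auto
    finally have "exp (- x * Suc n) \<le> (exp (- x * n) - exp (- x * Suc n)) / x"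
      using assms by (simp add: field_simps)
    moreover have "(\<Sum>j=1..Suc n. exp (- x * real j)) = (\<Sum>j=1..n. exp (- x * real j)) + exp (- x * Suc n)"
      by simp
    ultimately show ?case
      using Suc by (simp only:) (simp add: diff_divide_distrib)
  qed simp
  also have "\<dots> \<le> 1 / x" using assms by (simp add: divide_right_mono)
  finally show ?thesis .
qed

text \<open>Half of the exponent absorbs the factor \<open>real j\<close> at the price of
  \<open>2 / x\<close>; summing the remaining exponentials of rate \<open>x / 2\<close> gives
  another \<open>2 / x\<close>.\<close>

lemma sum_nat_exp_le:
  fixes x :: real and n :: nat
  assumes x: "0 < x"
  shows "(\<Sum>j=1..n. real j * exp (- x * real j)) \<le> 4 / x\<^sup>2"
proof -
  have "real j * exp (- x * j) \<le> 2 / x * exp (- (x / 2) * j)" for j :: nat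
  proof -
    have "x / 2 * j \<le> exp (x / 2 * j)"
      using exp_ge_add_one_self[of "x / 2 * j"] by linarith
    then have "x / 2 * j * exp (- x * j) \<le> exp (x / 2 * j) * exp (- x * j)"
      by (intro mult_right_mono) auto
    also have "\<dots> = exp (- (x / 2) * j)"
      by (simp add: exp_add[symmetric])
    finally show ?thesis using x by (simp add: field_simps)
  qed
  then have "(\<Sum>j=1..n. real j * exp (- x * real j)) \<le> (\<Sum>j=1..n. 2 / x * exp (- (x / 2) * real j))"
    by (intro sum_mono)
  also have "\<dots> = 2 / x * (\<Sum>j=1..n. exp (- (x / 2) * real j))"
    by (simp add: sum_distrib_left)
  also have "\<dots> \<le> 2 / x * (1 / (x / 2))"
    using x by (intro mult_left_mono sum_exp_le) auto
  finally show ?thesis by (simp add: power2_eq_square)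
qed

section \<open>Covariances and second moments of sums along the chain\<close>

context stationary_kernel_chain
begin

text \<open>Conditioning at time \<open>i\<close> turns the product into a function
  \<open>\<psi>\<close> of \<open>X i\<close> alone. Its stationary mean gives the first term; the
  second is the effect of the initial law on the centred \<open>\<psi>\<close>, and it decays in
  both \<open>i\<close> and \<open>k\<close>.\<close>

lemma covariance_bound:
  fixes \<phi> :: "'a \<Rightarrow> real"
  assumes \<phi>: "\<phi> \<in> borel_measurable borel" "\<And>x. \<bar>\<phi> x\<bar> \<le> B"
    and mean: "(\<integral>x. \<phi> x \<partial>\<pi>) = 0"
  defines "V \<equiv> (\<integral>x. (\<phi> x)\<^sup>2 \<partial>\<pi>)" and "\<gamma> \<equiv> gap \<pi> K"
  shows "(\<integral>\<omega>. \<phi> (X i \<omega>) * \<phi> (X (i + k) \<omega>) \<partial>M)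
    \<le> V * exp (- \<gamma> * k) + H * B * sqrt V * exp (- \<gamma> * (i + k))"
proof -
  note [measurable] = \<phi>(1)
  define \<eta> where "\<eta> = (markov_op K ^^ k) \<phi>"
  have [measurable]: "\<eta> \<in> borel_measurable borel" unfolding \<eta>_def by measurable
  have \<eta>: "\<bar>\<eta> x\<bar> \<le> B" for x
    unfolding \<eta>_def by (rule markov_op_pow_bound[OF \<phi>])
  have B: "0 \<le> B" using \<phi>(2)[of undefined] by simp
  have V: "0 \<le> V" unfolding V_def by simp
  have sq: "integrable \<pi> (\<lambda>x. (u x)\<^sup>2)" if "u \<in> borel_measurable borel" "\<And>x. \<bar>u x\<bar> \<le> C"
    for u and C :: real
    using that(1) power_mono[OF that(2), where n=2] by (intro integrable_pi[of _ "C\<^sup>2"]) auto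
  have \<eta>2: "(\<integral>x. (\<eta> x)\<^sup>2 \<partial>\<pi>) \<le> (exp (- \<gamma> * k))\<^sup>2 * V"
    unfolding \<eta>_def V_def \<gamma>_def by (rule markov_op_pow_contraction[OF \<phi> mean])
  define \<psi> where "\<psi> x = \<phi> x * \<eta> x" for x
  have [measurable]: "\<psi> \<in> borel_measurable borel" unfolding \<psi>_def by measurable
  have \<psi>: "\<bar>\<psi> x\<bar> \<le> B * B" for x
    unfolding \<psi>_def abs_mult using \<phi>(2) \<eta> B by (intro mult_mono) auto
  define m where "m = (\<integral>x. \<psi> x \<partial>\<pi>)"
  have i\<psi>: "integrable \<pi> \<psi>" by (rule integrable_pi[OF _ \<psi>]) measurable
  define a where "a = exp (- \<gamma> * k)"
  have a: "a > 0" by (simp add: a_def)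
  have m: "m \<le> V * a"
  proof -
    \<comment> \<open>Young's inequality replaces Cauchy-Schwarz. With the weight \<open>a\<close>
      each of the two terms integrates to at most \<open>a * V / 2\<close>.\<close>
    have "\<psi> x \<le> (a * (\<phi> x)\<^sup>2 + (\<eta> x)\<^sup>2 / a) / 2" for x
    proof -
      have "0 \<le> (a * \<phi> x - \<eta> x)\<^sup>2 / a" using a by simp
      also have "\<dots> = a * (\<phi> x)\<^sup>2 - 2 * \<psi> x + (\<eta> x)\<^sup>2 / a"
        using a by (simp add: \<psi>_def power2_eq_square field_simps)
      finally show ?thesis by simp
    qed
    then have "m \<le> (\<integral>x. (a * (\<phi> x)\<^sup>2 + (\<eta> x)\<^sup>2 / a) / 2 \<partial>\<pi>)"
      unfolding m_def using i\<psi> sq[OF \<phi>] sq[OF _ \<eta>] by (intro integral_mono) auto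
    also have "\<dots> = (a * V + (\<integral>x. (\<eta> x)\<^sup>2 \<partial>\<pi>) / a) / 2"
      using sq[OF \<phi>] sq[OF _ \<eta>] by (simp add: V_def)
    also have "\<dots> \<le> (a * V + (a\<^sup>2 * V) / a) / 2"
      using \<eta>2 a by (simp add: a_def divide_right_mono)
    also have "\<dots> = V * a" using a by (simp add: power2_eq_square)
    finally show ?thesis .
  qed
  define \<psi>0 where "\<psi>0 x = \<psi> x - m" for x
  have \<psi>0: "\<psi>0 \<in> borel_measurable borel" "\<bar>\<psi>0 x\<bar> \<le> B * B + \<bar>m\<bar>" "(\<integral>x. \<psi>0 x \<partial>\<pi>) = 0" for x
    unfolding \<psi>0_def using abs_triangle_ineq4[of "\<psi> x" m] \<psi>[of x] i\<psi>
    by (auto simp: m_def prob_space[simplified])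
  have iM: "integrable M (\<lambda>\<omega>. \<psi> (X i \<omega>))"
    using \<psi> by (intro M.integrable_const_bound[of _ "B * B"]) auto
  have "(\<integral>x. (\<psi>0 x)\<^sup>2 \<partial>\<pi>) = (\<integral>x. (\<psi> x)\<^sup>2 \<partial>\<pi>) - m\<^sup>2"
    unfolding \<psi>0_def m_def by (rule variance_eq[OF i\<psi> sq[OF _ \<psi>]]) measurable
  also have "\<dots> \<le> (\<integral>x. (\<psi> x)\<^sup>2 \<partial>\<pi>)" by simp
  \<comment> \<open>Only the factor \<open>\<phi>\<close> is bounded uniformly; the other keeps its
    decay in \<open>k\<close>.\<close>
  also have "\<dots> \<le> (\<integral>x. B\<^sup>2 * (\<eta> x)\<^sup>2 \<partial>\<pi>)"
    using sq[OF _ \<psi>] sq[OF _ \<eta>] power_mono[OF \<phi>(2), where n=2]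
    by (intro integral_mono) (auto simp: \<psi>_def power_mult_distrib mult_right_mono)
  also have "\<dots> \<le> B\<^sup>2 * (a\<^sup>2 * V)"
    using \<eta>2 by (simp add: a_def mult_left_mono)
  finally have s: "sqrt (\<integral>x. (\<psi>0 x)\<^sup>2 \<partial>\<pi>) \<le> B * a * sqrt V"
    using B a V by (intro real_le_lsqrt) (auto simp: power_mult_distrib)
  have "(\<integral>\<omega>. \<phi> (X i \<omega>) * \<phi> (X (i + k) \<omega>) \<partial>M) = (\<integral>\<omega>. \<psi> (X i \<omega>) \<partial>M)"
    using expectation_markov_op_pow[OF \<phi> \<phi>, of i k] by (simp add: \<psi>_def \<eta>_def)
  also have "\<dots> = m + (\<integral>\<omega>. \<psi>0 (X i \<omega>) \<partial>M)"
    using iM by (simp add: \<psi>0_def M.prob_space)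
  also have "\<dots> \<le> V * a + H * exp (- \<gamma> * i) * sqrt (\<integral>x. (\<psi>0 x)\<^sup>2 \<partial>\<pi>)"
    using m abs_expectation_X_le[OF \<psi>0, of i] unfolding \<gamma>_def by linarith
  also have "\<dots> \<le> V * a + H * exp (- \<gamma> * i) * (B * a * sqrt V)"
    using s H_nonneg by (intro add_left_mono mult_left_mono) auto
  also have "H * exp (- \<gamma> * i) * (B * a * sqrt V) = H * B * sqrt V * exp (- \<gamma> * (i + k))"
    by (simp add: a_def distrib_left exp_diff exp_minus divide_inverse)
  finally show ?thesis by (simp add: a_def)
qed

text \<open>Adding one more time creates cross terms with all earlier times. Their stationary parts
  contribute at most \<open>2 * V / \<gamma>\<close> and the diagonal at most
  \<open>V / \<gamma>\<close>, hence the 3; the 8 is twice the constant of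
  \<open>sum_nat_exp_le\<close>.\<close>

lemma second_moment_sum:
  fixes \<phi> :: "'a \<Rightarrow> real"
  assumes \<phi>: "\<phi> \<in> borel_measurable borel" "\<And>x. \<bar>\<phi> x\<bar> \<le> B"
    and mean: "(\<integral>x. \<phi> x \<partial>\<pi>) = 0" and gap: "0 < gap \<pi> K"
  defines "V \<equiv> (\<integral>x. (\<phi> x)\<^sup>2 \<partial>\<pi>)" and "\<gamma> \<equiv> gap \<pi> K"
  shows "(\<integral>\<omega>. (\<Sum>j=1..n. \<phi> (X (j + m) \<omega>))\<^sup>2 \<partial>M)
    \<le> n * (3 * V / \<gamma>) + 8 * H * B * sqrt V * exp (- \<gamma> * m) / \<gamma>\<^sup>2"
proof -
  note [measurable] = \<phi>(1)
  have \<gamma>: "0 < \<gamma>" "\<gamma> \<le> 1" using gap gap_le_1 by (auto simp: \<gamma>_def)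
  have B: "0 \<le> B" using \<phi>(2)[of undefined] by simp
  have V: "0 \<le> V" unfolding V_def by simp
  define D where "D = H * B * sqrt V * exp (- \<gamma> * m)"
  have D: "0 \<le> D" unfolding D_def using H_nonneg B V by simp
  let ?c = "\<lambda>i j. \<integral>\<omega>. \<phi> (X (i + m) \<omega>) * \<phi> (X (j + m) \<omega>) \<partial>M"
  \<comment> \<open>The non-stationary term depends on the later index only, so all cross terms of
    one induction step share it; the burn-in factor is part of \<open>D\<close>.\<close>
  have c: "?c i j \<le> V * exp (- \<gamma> * (j - i)) + D * exp (- \<gamma> * j)" if "i \<le> j" for i j :: nat
    using covariance_bound[OF \<phi> mean, of "i + m" "j - i"] that
    by (simp add: V_def \<gamma>_def D_def of_nat_diff distrib_left exp_diff exp_minus divide_inverse ac_simps)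
  have i: "integrable M (\<lambda>\<omega>. \<phi> (X i \<omega>) * \<phi> (X j \<omega>))" for i j
    using \<phi>(2) B by (intro M.integrable_const_bound[of _ "B * B"]) (auto simp: abs_mult intro!: mult_mono)
  let ?S = "\<lambda>n \<omega>. \<Sum>j=1..n. \<phi> (X (j + m) \<omega>)"
  have "(\<integral>\<omega>. (?S n \<omega>)\<^sup>2 \<partial>M) \<le> n * (3 * V / \<gamma>) + D * (\<Sum>l=1..n. 2 * (real l * exp (- \<gamma> * real l)))"
  proof (induction n)
    case (Suc n)
    have S2: "integrable M (\<lambda>\<omega>. (?S n \<omega>)\<^sup>2)"
      unfolding power2_eq_square sum_product using i by (intro Bochner_Integration.integrable_sum)
    have "(?S (Suc n) \<omega>)\<^sup>2 = (?S n \<omega>)\<^sup>2 + 2 * (\<Sum>j=1..n. \<phi> (X (j + m) \<omega>) * \<phi> (X (Suc n + m) \<omega>))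
        + \<phi> (X (Suc n + m) \<omega>) * \<phi> (X (Suc n + m) \<omega>)" for \<omega>
      by (simp add: power2_eq_square sum_distrib_left sum_distrib_right algebra_simps)
    then have "(\<integral>\<omega>. (?S (Suc n) \<omega>)\<^sup>2 \<partial>M)
        = (\<integral>\<omega>. (?S n \<omega>)\<^sup>2 \<partial>M) + 2 * (\<Sum>j=1..n. ?c j (Suc n)) + ?c (Suc n) (Suc n)"
      using S2 i by simp
    moreover have "(\<Sum>j=1..n. ?c j (Suc n)) \<le> V / \<gamma> + n * (D * exp (- \<gamma> * Suc n))"
    proof -
      have "(\<Sum>j=1..n. ?c j (Suc n))
          \<le> (\<Sum>j=1..n. V * exp (- \<gamma> * (real (Suc n) - real j)) + D * exp (- \<gamma> * Suc n))"
        using c[of _ "Suc n"] by (intro sum_mono) auto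
      also have "\<dots> = V * (\<Sum>j=1..n. exp (- \<gamma> * (real (Suc n) - real j))) + n * (D * exp (- \<gamma> * Suc n))"
        by (simp add: sum.distrib sum_distrib_left)
      \<comment> \<open>Time reversal: the distances from \<open>Suc n\<close> to
        \<open>1, ..., n\<close> are again \<open>1, ..., n\<close>.\<close>
      also have "(\<Sum>j=1..n. exp (- \<gamma> * (real (Suc n) - real j))) = (\<Sum>j=1..n. exp (- \<gamma> * real j))"
        by (rule sum.reindex_bij_witness[of _ "\<lambda>j. Suc n - j" "\<lambda>j. Suc n - j"])
           (auto simp: of_nat_diff)
      also have "V * \<dots> \<le> V * (1 / \<gamma>)"
        using \<gamma> V by (intro mult_left_mono sum_exp_le)
      finally show ?thesis by simp
    qed
    moreover have "?c (Suc n) (Suc n) \<le> V + D * exp (- \<gamma> * Suc n)"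
      using c[of "Suc n" "Suc n"] by simp
    \<comment> \<open>Here \<open>gap \<pi> K \<le> 1\<close> enters.\<close>
    moreover have "V \<le> V / \<gamma>"
      using \<gamma> V by (simp add: field_simps mult_left_le)
    moreover have "0 \<le> D * exp (- \<gamma> * Suc n)" using D by simp
    moreover have "D * (\<Sum>l=1..Suc n. 2 * (real l * exp (- \<gamma> * real l))) =
        D * (\<Sum>l=1..n. 2 * (real l * exp (- \<gamma> * real l))) + 2 * (n * (D * exp (- \<gamma> * Suc n)))
        + 2 * (D * exp (- \<gamma> * Suc n))"
      by (simp add: algebra_simps)
    moreover have "Suc n * (3 * V / \<gamma>) = n * (3 * V / \<gamma>) + 3 * (V / \<gamma>)"
      by (simp add: algebra_simps add_divide_distrib)
    ultimately show ?case using Suc.IH by linarith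
  qed simp
  also have "\<dots> \<le> n * (3 * V / \<gamma>) + D * (2 * (4 / \<gamma>\<^sup>2))"
    using D \<gamma> sum_nat_exp_le[of \<gamma> n]
    by (intro add_left_mono mult_left_mono) (auto simp: sum_distrib_left[symmetric])
  finally show ?thesis by (simp add: D_def ac_simps)
qed

end

section \<open>Truncation at a level\<close>

definition trunc :: "real \<Rightarrow> real \<Rightarrow> real" where
  "trunc s y = (if \<bar>y\<bar> \<le> s then y else 0)"

lemma measurable_trunc [measurable]: "trunc s \<in> borel_measurable borel"
  unfolding trunc_def by measurable

lemma abs_trunc_le: "0 \<le> s \<Longrightarrow> \<bar>trunc s y\<bar> \<le> s"
  by (simp add: trunc_def)

text \<open>Below the level, the missing \<open>2 - p\<close> powers of \<open>\<bar>y\<bar>\<close>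
  are bounded by those of \<open>s\<close>.\<close>

lemma trunc_square_le:
  assumes "0 < s" "p \<le> 2"
  shows "(trunc s y)\<^sup>2 \<le> s powr (2 - p) * \<bar>y\<bar> powr p"
proof (cases "y = 0 \<or> s < \<bar>y\<bar>")
  case False
  then have "(trunc s y)\<^sup>2 = \<bar>y\<bar> powr (2 - p) * \<bar>y\<bar> powr p"
    by (simp add: trunc_def powr_add[symmetric])
  also have "\<dots> \<le> s powr (2 - p) * \<bar>y\<bar> powr p"
    using False assms by (intro mult_right_mono powr_mono2) auto
  finally show ?thesis .
qed (use assms in \<open>auto simp: trunc_def\<close>)

text \<open>Above the level, the exponent \<open>1 - p\<close> is not positive, so the power
  decreases in its base.\<close>

lemma trunc_remainder_le:
  assumes "0 < s" "1 \<le> p"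
  shows "\<bar>y - trunc s y\<bar> \<le> s powr (1 - p) * \<bar>y\<bar> powr p"
proof (cases "\<bar>y\<bar> \<le> s")
  case False
  then have "\<bar>y - trunc s y\<bar> = \<bar>y\<bar> powr (1 - p) * \<bar>y\<bar> powr p"
    using assms by (simp add: trunc_def powr_add[symmetric])
  also have "\<dots> \<le> s powr (1 - p) * \<bar>y\<bar> powr p"
    using False assms by (intro mult_right_mono powr_mono2') auto
  finally show ?thesis .
qed (use assms in \<open>auto simp: trunc_def\<close>)

lemma abs_le_1_plus_powr: "\<bar>y\<bar> \<le> 1 + \<bar>y\<bar> powr p" if "1 \<le> p" for y p :: real
proof (cases "\<bar>y\<bar> \<le> 1")
  case False
  then have "\<bar>y\<bar> powr 1 \<le> \<bar>y\<bar> powr p" using that by (intro powr_mono) auto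
  then show ?thesis using False by simp
qed (use powr_ge_zero[of "\<bar>y\<bar>" p] in linarith)

section \<open>Functions in the unit ball of L_p evaluated along the chain\<close>

context stationary_kernel_chain
begin

text \<open>Using the \<open>p\<close>-th power of the norm and a Bochner integral keeps membership
  free of roots and of \<open>ennreal\<close>; \<open>theorem2\<close> rescales \<open>f\<close>
  into this ball.\<close>

definition Lp_ball :: "real \<Rightarrow> ('a \<Rightarrow> real) set" where
  "Lp_ball p = {f \<in> borel_measurable borel. integrable \<pi> (\<lambda>x. \<bar>f x\<bar> powr p) \<and> (\<integral>x. \<bar>f x\<bar> powr p \<partial>\<pi>) \<le> 1}"

lemma Lp_ball_dominated:
  assumes f: "f \<in> Lp_ball p" and [measurable]: "g \<in> borel_measurable borel"
    and le: "\<And>x. \<bar>g x\<bar> \<le> c * \<bar>f x\<bar> powr p" and c: "0 \<le> c"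
  shows "integrable \<pi> g" "(\<integral>x. \<bar>g x\<bar> \<partial>\<pi>) \<le> c"
proof -
  have ip: "integrable \<pi> (\<lambda>x. c * \<bar>f x\<bar> powr p)"
    using f by (simp add: Lp_ball_def)
  show i: "integrable \<pi> g"
    by (rule Bochner_Integration.integrable_bound[OF ip]) (use le c in \<open>auto simp: abs_mult\<close>)
  have "(\<integral>x. \<bar>g x\<bar> \<partial>\<pi>) \<le> (\<integral>x. c * \<bar>f x\<bar> powr p \<partial>\<pi>)"
    using i ip le by (intro integral_mono) auto
  also have "\<dots> \<le> c * 1"
    using f c by (simp add: Lp_ball_def mult_left_le)
  finally show "(\<integral>x. \<bar>g x\<bar> \<partial>\<pi>) \<le> c" by simp
qed

lemma Lp_ball_trunc:
  assumes f: "f \<in> Lp_ball p" and s: "0 < s" and p: "1 \<le> p" "p \<le> 2"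
  shows "(\<integral>x. (trunc s (f x))\<^sup>2 \<partial>\<pi>) \<le> s powr (2 - p)"
    and "integrable \<pi> (\<lambda>x. f x - trunc s (f x))"
    and "(\<integral>x. \<bar>f x - trunc s (f x)\<bar> \<partial>\<pi>) \<le> s powr (1 - p)"
proof -
  have [measurable]: "f \<in> borel_measurable borel" using f by (simp add: Lp_ball_def)
  show "(\<integral>x. (trunc s (f x))\<^sup>2 \<partial>\<pi>) \<le> s powr (2 - p)"
    using Lp_ball_dominated(2)[OF f, of "\<lambda>x. (trunc s (f x))\<^sup>2" "s powr (2 - p)"]
      trunc_square_le[OF s p(2)] by simp
  show "integrable \<pi> (\<lambda>x. f x - trunc s (f x))"
    and "(\<integral>x. \<bar>f x - trunc s (f x)\<bar> \<partial>\<pi>) \<le> s powr (1 - p)"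
    using Lp_ball_dominated[OF f, of "\<lambda>x. f x - trunc s (f x)" "s powr (1 - p)"]
      trunc_remainder_le[OF s p(1)] by auto
qed

text \<open>The pointwise bound \<open>\<bar>y\<bar> \<le> 1 + \<bar>y\<bar> powr p\<close> gives
  the crude constant 2, which is enough for the case of a small \<open>N\<close>.\<close>

lemma Lp_ball_integrable:
  assumes f: "f \<in> Lp_ball p" and p: "1 \<le> p"
  shows "integrable \<pi> f" "(\<integral>x. \<bar>f x\<bar> \<partial>\<pi>) \<le> 2"
proof -
  have [measurable]: "f \<in> borel_measurable borel" and ip: "integrable \<pi> (\<lambda>x. 1 + \<bar>f x\<bar> powr p)"
    using f by (auto simp: Lp_ball_def)
  show i: "integrable \<pi> f"
    by (rule Bochner_Integration.integrable_bound[OF ip])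
      (use abs_le_1_plus_powr[OF p] in \<open>auto intro: order_trans\<close>)
  have "(\<integral>x. \<bar>f x\<bar> \<partial>\<pi>) \<le> (\<integral>x. 1 + \<bar>f x\<bar> powr p \<partial>\<pi>)"
    using i ip abs_le_1_plus_powr[OF p] by (intro integral_mono) auto
  also have "\<dots> \<le> 2"
    using f by (simp add: Lp_ball_def prob_space[simplified])
  finally show "(\<integral>x. \<bar>f x\<bar> \<partial>\<pi>) \<le> 2" .
qed

text \<open>
  Real interpolation in place of Riesz--Thorin: the part of \<open>f\<close> below the level \<open>s\<close> is handled by
  the \<open>L\<^sub>2\<close> gap, the part above by the density bound, and \<open>s\<close> balances the two contributions.
\<close>
lemma expectation_abs_le:
  assumes f: "f \<in> Lp_ball p" and \<delta>: "0 < \<delta>" "\<delta> \<le> 1" and p: "1 + \<delta> < p" "p \<le> 2"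
  defines "\<gamma> \<equiv> gap \<pi> K"
  shows "(\<integral>\<^sup>+\<omega>. \<bar>f (X i \<omega>)\<bar> \<partial>M) \<le> ennreal ((\<integral>x. \<bar>f x\<bar> \<partial>\<pi>) + 2 * H * exp (- (\<delta> * \<gamma>) * i))"
proof -
  have [measurable]: "f \<in> borel_measurable borel" using f by (simp add: Lp_ball_def)
  have p1: "1 \<le> p" using p \<delta> by simp
  have \<gamma>: "0 \<le> \<gamma>" using gap_nonneg by (simp add: \<gamma>_def)
  \<comment> \<open>The level solves
    \<open>exp (- \<gamma> * i) * s powr (1 - p / 2) = s powr (1 - p)\<close>, which equates the
    decay of the lower and the upper part.\<close>
  define s where "s = exp (2 * \<gamma> * i / p)"
  have s: "0 < s" by (simp add: s_def)
  define u where "u x = \<bar>trunc s (f x)\<bar>" for x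
  define v where "v x = \<bar>f x - trunc s (f x)\<bar>" for x
  have [measurable]: "u \<in> borel_measurable borel" "v \<in> borel_measurable borel"
    unfolding u_def v_def by measurable
  have uv: "\<bar>f x\<bar> = u x + v x" for x
    by (simp add: u_def v_def trunc_def)
  have u: "\<bar>u x\<bar> \<le> s" "0 \<le> u x" for x
    using abs_trunc_le[of s] s by (auto simp: u_def)
  have v: "0 \<le> v x" for x by (simp add: v_def)
  have u2: "(\<integral>x. (u x)\<^sup>2 \<partial>\<pi>) \<le> s powr (2 - p)"
    unfolding u_def using Lp_ball_trunc(1)[OF f s p1 p(2)] by simp
  have iv: "integrable \<pi> v" and v1: "(\<integral>x. v x \<partial>\<pi>) \<le> s powr (1 - p)"
    using Lp_ball_trunc(2,3)[OF f s p1 p(2)] unfolding v_def by (auto intro: integrable_abs)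
  have iu: "integrable \<pi> u" by (rule integrable_pi[OF _ u(1)]) measurable
  have iu2: "integrable \<pi> (\<lambda>x. (u x)\<^sup>2)"
    using power_mono[OF u(1), where n=2] by (intro integrable_pi[of _ "s\<^sup>2"]) auto
  have iuM: "integrable M (\<lambda>\<omega>. u (X i \<omega>))"
    using u by (intro M.integrable_const_bound[of _ s]) auto
  define m where "m = (\<integral>x. u x \<partial>\<pi>)"
  have u0: "\<bar>u x - m\<bar> \<le> s + \<bar>m\<bar>" for x
    using abs_triangle_ineq4[of "u x" m] u(1)[of x] by simp
  have u0m: "(\<integral>x. u x - m \<partial>\<pi>) = 0"
    using iu by (simp add: m_def prob_space[simplified])
  have u02: "(\<integral>x. (u x - m)\<^sup>2 \<partial>\<pi>) \<le> s powr (2 - p)"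
    using variance_eq[OF iu iu2, folded m_def] u2 zero_le_power2[of m] by linarith
  have "(\<integral>\<omega>. u (X i \<omega>) \<partial>M) = m + (\<integral>\<omega>. u (X i \<omega>) - m \<partial>M)"
    using iuM by (simp add: M.prob_space)
  also have "\<dots> \<le> m + H * exp (- \<gamma> * i) * sqrt (\<integral>x. (u x - m)\<^sup>2 \<partial>\<pi>)"
    using abs_expectation_X_le[OF _ u0 u0m, of i] unfolding \<gamma>_def by simp
  also have "\<dots> \<le> m + H * exp (- \<gamma> * i) * sqrt (s powr (2 - p))"
    using u02 H_nonneg by (intro add_left_mono mult_left_mono real_sqrt_le_mono) auto
  also have "sqrt (s powr (2 - p)) = exp (2 * \<gamma> * i / p * (1 - p / 2))"
    by (simp add: s_def powr_half_sqrt[symmetric] powr_def)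
  also have "H * exp (- \<gamma> * i) * exp (2 * \<gamma> * i / p * (1 - p / 2))
      = H * exp (2 * \<gamma> * i / p * (1 - p))"
    using p1 by (simp add: exp_add[symmetric] field_simps)
  finally have Eu: "(\<integral>\<omega>. u (X i \<omega>) \<partial>M) \<le> m + H * exp (2 * \<gamma> * i / p * (1 - p))" .
  have v1': "(\<integral>x. v x \<partial>\<pi>) \<le> exp (2 * \<gamma> * i / p * (1 - p))"
    using v1 by (simp add: s_def powr_def mult.commute)
  \<comment> \<open>The rate obtained is \<open>2 * (p - 1) / p\<close> times the gap; it is at
    least \<open>\<delta>\<close> times the gap since \<open>p \<le> 2\<close> and
    \<open>1 + \<delta> < p\<close>.\<close>
  have ex: "exp (2 * \<gamma> * i / p * (1 - p)) \<le> exp (- (\<delta> * \<gamma>) * i)"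
  proof -
    have "\<delta> * p \<le> \<delta> * 2" using \<delta> p by (intro mult_left_mono) auto
    also have "\<dots> \<le> 2 * (p - 1)" using p by simp
    finally have "\<delta> * p \<le> 2 * (p - 1)" .
    then have "\<delta> \<le> 2 * (p - 1) / p"
      using p1 by (simp add: pos_le_divide_eq)
    then have "(\<gamma> * i) * \<delta> \<le> (\<gamma> * i) * (2 * (p - 1) / p)"
      using \<gamma> by (intro mult_left_mono) auto
    also have "\<dots> = - (2 * \<gamma> * i / p * (1 - p))"
      using p1 by (simp add: field_simps)
    finally show ?thesis by (simp add: algebra_simps)
  qed
  have "(\<integral>\<^sup>+\<omega>. \<bar>f (X i \<omega>)\<bar> \<partial>M) = (\<integral>\<^sup>+\<omega>. ennreal (u (X i \<omega>)) \<partial>M) + (\<integral>\<^sup>+\<omega>. ennreal (v (X i \<omega>)) \<partial>M)"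
    unfolding uv using u v by (subst nn_integral_add[symmetric]) auto
  also have "(\<integral>\<^sup>+\<omega>. ennreal (u (X i \<omega>)) \<partial>M) = ennreal (\<integral>\<omega>. u (X i \<omega>) \<partial>M)"
    using iuM u by (intro nn_integral_eq_integral) auto
  also have "(\<integral>\<^sup>+\<omega>. ennreal (v (X i \<omega>)) \<partial>M) \<le> ennreal (1 + H) * (\<integral>\<^sup>+x. ennreal (v x) \<partial>\<pi>)"
    by (rule nn_integral_X_le) measurable
  also have "(\<integral>\<^sup>+x. ennreal (v x) \<partial>\<pi>) = ennreal (\<integral>x. v x \<partial>\<pi>)"
    using iv v by (intro nn_integral_eq_integral) auto
  also have "ennreal (\<integral>\<omega>. u (X i \<omega>) \<partial>M) + ennreal (1 + H) * ennreal (\<integral>x. v x \<partial>\<pi>)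
      = ennreal ((\<integral>\<omega>. u (X i \<omega>) \<partial>M) + (1 + H) * (\<integral>x. v x \<partial>\<pi>))"
    using H_nonneg Bochner_Integration.integral_nonneg[of \<pi> v] Bochner_Integration.integral_nonneg[of M "\<lambda>\<omega>. u (X i \<omega>)"] u v
    by (simp add: ennreal_mult)
  also have "\<dots> \<le> ennreal ((\<integral>x. \<bar>f x\<bar> \<partial>\<pi>) + 2 * H * exp (- (\<delta> * \<gamma>) * i))"
  proof (rule ennreal_leI)
    \<comment> \<open>Only the multiple \<open>H\<close> of the integral of \<open>v\<close> is
      traded for decay; the other copy joins \<open>m\<close> to give exactly the L1 norm of
      \<open>f\<close>.\<close>
    have "(1 + H) * (\<integral>x. v x \<partial>\<pi>) \<le> (\<integral>x. v x \<partial>\<pi>) + H * exp (2 * \<gamma> * i / p * (1 - p))"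
      using mult_left_mono[OF v1' H_nonneg] by (simp add: distrib_right)
    moreover have "(\<integral>x. \<bar>f x\<bar> \<partial>\<pi>) = m + (\<integral>x. v x \<partial>\<pi>)"
      unfolding uv m_def using iu iv by simp
    moreover have "H * exp (2 * \<gamma> * i / p * (1 - p)) \<le> H * exp (- (\<delta> * \<gamma>) * i)"
      using mult_left_mono[OF ex H_nonneg] .
    ultimately show "(\<integral>\<omega>. u (X i \<omega>) \<partial>M) + (1 + H) * (\<integral>x. v x \<partial>\<pi>)
        \<le> (\<integral>x. \<bar>f x\<bar> \<partial>\<pi>) + 2 * H * exp (- (\<delta> * \<gamma>) * i)"
      using Eu by linarith
  qed
  finally show ?thesis by (auto intro: add_left_mono)
qed

lemma expectation_abs_X:
  assumes f: "f \<in> Lp_ball p" and \<delta>: "0 < \<delta>" "\<delta> \<le> 1" and p: "1 + \<delta> < p" "p \<le> 2"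
  shows "integrable M (\<lambda>\<omega>. f (X i \<omega>))"
    and "(\<integral>\<omega>. \<bar>f (X i \<omega>)\<bar> \<partial>M) \<le> (\<integral>x. \<bar>f x\<bar> \<partial>\<pi>) + 2 * H * exp (- (\<delta> * gap \<pi> K) * i)"
proof -
  have [measurable]: "f \<in> borel_measurable borel" using f by (simp add: Lp_ball_def)
  note le = expectation_abs_le[OF f \<delta> p, of i]
  show i: "integrable M (\<lambda>\<omega>. f (X i \<omega>))"
    by (rule integrableI_bounded) (use le in \<open>auto intro: order_le_less_trans\<close>)
  have "ennreal (\<integral>\<omega>. \<bar>f (X i \<omega>)\<bar> \<partial>M) = (\<integral>\<^sup>+\<omega>. \<bar>f (X i \<omega>)\<bar> \<partial>M)"
    using i by (intro nn_integral_eq_integral[symmetric]) auto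
  with le have "ennreal (\<integral>\<omega>. \<bar>f (X i \<omega>)\<bar> \<partial>M)
      \<le> ennreal ((\<integral>x. \<bar>f x\<bar> \<partial>\<pi>) + 2 * H * exp (- (\<delta> * gap \<pi> K) * i))"
    by simp
  then show "(\<integral>\<omega>. \<bar>f (X i \<omega>)\<bar> \<partial>M) \<le> (\<integral>x. \<bar>f x\<bar> \<partial>\<pi>) + 2 * H * exp (- (\<delta> * gap \<pi> K) * i)"
    using H_nonneg by (subst (asm) ennreal_le_iff) auto
qed

section \<open>The error of the average: L1 bound, L2 bound and their combination\<close>

lemma average_error_L1:
  assumes f: "f \<in> Lp_ball p" and \<delta>: "0 < \<delta>" "\<delta> \<le> 1" and p: "1 + \<delta> < p" "p \<le> 2"
    and burn_in: "H * exp (- (\<delta> * gap \<pi> K) * m) \<le> \<delta> / 64"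
  shows "integrable M (\<lambda>\<omega>. mcmc_average X n m f \<omega>)"
    and "(\<integral>\<omega>. \<bar>mcmc_average X n m f \<omega> - (\<integral>x. f x \<partial>\<pi>)\<bar> \<partial>M)
      \<le> 2 * (\<integral>x. \<bar>f x\<bar> \<partial>\<pi>) + \<delta> / (32 * real n) * (\<Sum>j=1..n. exp (- (\<delta> * gap \<pi> K) * real j))"
proof -
  note iX = expectation_abs_X[OF f \<delta> p]
  have p1: "1 \<le> p" using p \<delta> by simp
  define d where "d = \<delta> * gap \<pi> K"
  show i: "integrable M (\<lambda>\<omega>. mcmc_average X n m f \<omega>)"
    unfolding mcmc_average_def using iX(1) by simp
  \<comment> \<open>Average and mean are bounded separately, without any cancellation. This costs
    twice the L1 norm, which is harmless for the small remainder of a truncation.\<close>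
  have "\<bar>mcmc_average X n m f \<omega> - (\<integral>x. f x \<partial>\<pi>)\<bar>
      \<le> 1 / n * (\<Sum>j=1..n. \<bar>f (X (j + m) \<omega>)\<bar>) + (\<integral>x. \<bar>f x\<bar> \<partial>\<pi>)" for \<omega>
  proof -
    have "\<bar>mcmc_average X n m f \<omega>\<bar> \<le> 1 / n * (\<Sum>j=1..n. \<bar>f (X (j + m) \<omega>)\<bar>)"
      unfolding mcmc_average_def abs_mult by (simp add: divide_right_mono)
    moreover have "\<bar>\<integral>x. f x \<partial>\<pi>\<bar> \<le> (\<integral>x. \<bar>f x\<bar> \<partial>\<pi>)" by (rule integral_abs_bound)
    ultimately show ?thesis
      using abs_triangle_ineq4[of "mcmc_average X n m f \<omega>" "\<integral>x. f x \<partial>\<pi>"] by linarith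
  qed
  then have "(\<integral>\<omega>. \<bar>mcmc_average X n m f \<omega> - (\<integral>x. f x \<partial>\<pi>)\<bar> \<partial>M)
      \<le> (\<integral>\<omega>. 1 / n * (\<Sum>j=1..n. \<bar>f (X (j + m) \<omega>)\<bar>) + (\<integral>x. \<bar>f x\<bar> \<partial>\<pi>) \<partial>M)"
    using i iX(1) by (intro integral_mono) auto
  also have "\<dots> = 1 / n * (\<Sum>j=1..n. \<integral>\<omega>. \<bar>f (X (j + m) \<omega>)\<bar> \<partial>M) + (\<integral>x. \<bar>f x\<bar> \<partial>\<pi>)"
    using iX(1) by (simp add: M.prob_space)
  also have "\<dots> \<le> 1 / n * (\<Sum>j=1..n. (\<integral>x. \<bar>f x\<bar> \<partial>\<pi>) + \<delta> / 32 * exp (- d * real j)) + (\<integral>x. \<bar>f x\<bar> \<partial>\<pi>)"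
  proof (intro add_right_mono mult_left_mono sum_mono)
    fix j
    have "2 * H * exp (- d * real (j + m)) = 2 * exp (- d * j) * (H * exp (- d * m))"
      by (simp add: distrib_left exp_diff exp_minus divide_inverse)
    also have "\<dots> \<le> 2 * exp (- d * j) * (\<delta> / 64)"
      using burn_in by (intro mult_left_mono) (auto simp: d_def)
    finally show "(\<integral>\<omega>. \<bar>f (X (j + m) \<omega>)\<bar> \<partial>M) \<le> (\<integral>x. \<bar>f x\<bar> \<partial>\<pi>) + \<delta> / 32 * exp (- d * real j)"
      using iX(2)[of "j + m"] by (simp add: d_def)
  qed auto
  \<comment> \<open>For \<open>n = 0\<close> both quotients are 0 by the convention on division. The
    sum stays unevaluated since the cases of small and large \<open>N\<close> bound it
    differently.\<close>
  also have "\<dots> \<le> 2 * (\<integral>x. \<bar>f x\<bar> \<partial>\<pi>) + \<delta> / (32 * real n) * (\<Sum>j=1..n. exp (- d * real j))"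
    unfolding sum.distrib sum_distrib_left[symmetric] by (cases "n = 0") (auto simp: field_simps)
  finally show "(\<integral>\<omega>. \<bar>mcmc_average X n m f \<omega> - (\<integral>x. f x \<partial>\<pi>)\<bar> \<partial>M)
      \<le> 2 * (\<integral>x. \<bar>f x\<bar> \<partial>\<pi>) + \<delta> / (32 * real n) * (\<Sum>j=1..n. exp (- (\<delta> * gap \<pi> K) * real j))"
    by (simp add: d_def)
qed

text \<open>The mean absolute error is at most the root mean square error, and
  \<open>second_moment_sum\<close> applies to the centred \<open>g\<close>. Centring doubles the
  uniform bound and does not increase the second moment.\<close>

lemma average_error_L2:
  fixes g :: "'a \<Rightarrow> real" and n :: nat
  assumes g: "g \<in> borel_measurable borel" "\<And>x. \<bar>g x\<bar> \<le> T"
    and V: "(\<integral>x. (g x)\<^sup>2 \<partial>\<pi>) \<le> V" and gap: "0 < gap \<pi> K" and n: "1 \<le> n"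
    and burn_in: "H * exp (- gap \<pi> K * m) \<le> 1 / 64"
  defines "N \<equiv> n * gap \<pi> K"
  shows "integrable M (\<lambda>\<omega>. mcmc_average X n m g \<omega>)"
    and "(\<integral>\<omega>. \<bar>mcmc_average X n m g \<omega> - (\<integral>x. g x \<partial>\<pi>)\<bar> \<partial>M)
      \<le> sqrt (3 * V / N + T * sqrt V / (4 * N\<^sup>2))"
proof -
  note [measurable] = g(1)
  define \<gamma> where "\<gamma> = gap \<pi> K"
  have \<gamma>: "0 < \<gamma>" using gap by (simp add: \<gamma>_def)
  have T: "0 \<le> T" using g(2)[of undefined] by simp
  have n0: "real n > 0" using n by simp
  have gM: "integrable M (\<lambda>\<omega>. g (X i \<omega>))" for i
    using g(2) by (intro M.integrable_const_bound[of _ T]) auto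
  show i: "integrable M (\<lambda>\<omega>. mcmc_average X n m g \<omega>)"
    unfolding mcmc_average_def using gM by simp
  have ig: "integrable \<pi> g" by (rule integrable_pi[OF g])
  have ig2: "integrable \<pi> (\<lambda>x. (g x)\<^sup>2)"
    using power_mono[OF g(2), where n=2] by (intro integrable_pi[of _ "T\<^sup>2"]) auto
  define c where "c = (\<integral>x. g x \<partial>\<pi>)"
  have "\<bar>c\<bar> \<le> (\<integral>x. \<bar>g x\<bar> \<partial>\<pi>)" unfolding c_def by (rule integral_abs_bound)
  also have "\<dots> \<le> (\<integral>x. T \<partial>\<pi>)" using ig g(2) by (intro integral_mono) auto
  finally have c: "\<bar>c\<bar> \<le> T" by (simp add: prob_space[simplified])
  define \<phi> where "\<phi> x = g x - c" for x
  have \<phi>: "\<phi> \<in> borel_measurable borel" "\<bar>\<phi> x\<bar> \<le> 2 * T" "(\<integral>x. \<phi> x \<partial>\<pi>) = 0" for x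
    unfolding \<phi>_def using abs_triangle_ineq4[of "g x" c] g(2)[of x] c ig
    by (auto simp: c_def prob_space[simplified])
  note [measurable] = \<phi>(1)
  define W where "W = (\<integral>x. (\<phi> x)\<^sup>2 \<partial>\<pi>)"
  have W: "0 \<le> W" by (simp add: W_def)
  have WV: "W \<le> V"
    using variance_eq[OF ig ig2, folded c_def] V zero_le_power2[of c]
    unfolding W_def \<phi>_def by linarith
  have avg: "mcmc_average X n m g \<omega> - c = (\<Sum>j=1..n. \<phi> (X (j + m) \<omega>)) / n" for \<omega>
    using n0 by (simp add: mcmc_average_def \<phi>_def sum_subtractf field_simps)
  define S where "S \<omega> = (\<Sum>j=1..n. \<phi> (X (j + m) \<omega>)) / n" for \<omega>
  have "\<bar>S \<omega>\<bar> \<le> n * (2 * T) / n" for \<omega>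
  proof -
    have "\<bar>\<Sum>j=1..n. \<phi> (X (j + m) \<omega>)\<bar> \<le> (\<Sum>j=1..n. \<bar>\<phi> (X (j + m) \<omega>)\<bar>)"
      by (rule sum_abs)
    also have "\<dots> \<le> (\<Sum>j=1..n. 2 * T)"
      using \<phi>(2) by (intro sum_mono)
    finally show ?thesis using n0 by (simp add: S_def field_simps)
  qed
  moreover have [measurable]: "S \<in> borel_measurable M" unfolding S_def by measurable
  ultimately have "(\<integral>\<omega>. \<bar>S \<omega>\<bar> \<partial>M) \<le> sqrt (\<integral>\<omega>. (S \<omega>)\<^sup>2 \<partial>M)"
    by (intro M.abs_integral_le_sqrt)
  also have "\<dots> \<le> sqrt (3 * V / N + T * sqrt V / (4 * N\<^sup>2))"
  proof (rule real_sqrt_le_mono)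
    \<comment> \<open>The constant 16 against the 1/64 of the burn-in leaves the 1/4 of the
      claim.\<close>
    have "8 * H * (2 * T) * sqrt W * exp (- \<gamma> * m) = 16 * T * sqrt W * (H * exp (- \<gamma> * m))"
      by simp
    also have "\<dots> \<le> 16 * T * sqrt V * (1 / 64)"
      using burn_in T W WV by (intro mult_mono) (auto simp: \<gamma>_def H_nonneg)
    finally have D: "8 * H * (2 * T) * sqrt W * exp (- \<gamma> * m) \<le> T * sqrt V / 4" by simp
    have "(\<integral>\<omega>. (S \<omega>)\<^sup>2 \<partial>M) = (\<integral>\<omega>. (\<Sum>j=1..n. \<phi> (X (j + m) \<omega>))\<^sup>2 \<partial>M) / n\<^sup>2"
      by (simp add: S_def power_divide)
    also have "\<dots> \<le> (n * (3 * W / \<gamma>) + 8 * H * (2 * T) * sqrt W * exp (- \<gamma> * m) / \<gamma>\<^sup>2) / n\<^sup>2"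
      using second_moment_sum[OF \<phi> gap, where n=n and m=m]
      unfolding W_def \<gamma>_def by (intro divide_right_mono) auto
    also have "\<dots> \<le> (n * (3 * V / \<gamma>) + (T * sqrt V / 4) / \<gamma>\<^sup>2) / n\<^sup>2"
      using \<gamma> W WV D by (intro divide_right_mono add_mono mult_left_mono) auto
    also have "\<dots> = 3 * V / N + T * sqrt V / (4 * N\<^sup>2)"
      using \<gamma> n0 by (simp add: N_def \<gamma>_def[symmetric] power2_eq_square field_simps)
    finally show "(\<integral>\<omega>. (S \<omega>)\<^sup>2 \<partial>M) \<le> 3 * V / N + T * sqrt V / (4 * N\<^sup>2)" .
  qed
  finally show "(\<integral>\<omega>. \<bar>mcmc_average X n m g \<omega> - (\<integral>x. g x \<partial>\<pi>)\<bar> \<partial>M)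
      \<le> sqrt (3 * V / N + T * sqrt V / (4 * N\<^sup>2))"
    unfolding c_def[symmetric] avg S_def .
qed

lemma average_error:
  assumes f: "f \<in> Lp_ball p" and \<delta>: "0 < \<delta>" "\<delta> \<le> 1" and p: "1 + \<delta> < p" "p \<le> 2"
    and gap: "0 < gap \<pi> K" and n: "1 \<le> n"
    and burn_in: "H * exp (- (\<delta> * gap \<pi> K) * m) \<le> \<delta> / 64"
  defines "N \<equiv> n * gap \<pi> K"
  shows "integrable M (\<lambda>\<omega>. mcmc_average X n m f \<omega>)"
    and "(\<integral>\<omega>. \<bar>mcmc_average X n m f \<omega> - (\<integral>x. f x \<partial>\<pi>)\<bar> \<partial>M) \<le> 8 / N powr (1 - (1 + \<delta>) / p)"
proof -
  have [measurable]: "f \<in> borel_measurable borel" using f by (simp add: Lp_ball_def)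
  have p1: "1 \<le> p" "0 < p" using p \<delta> by auto
  have N: "0 < N" using gap n by (simp add: N_def)
  define d where "d = \<delta> * gap \<pi> K"
  have d: "0 < d" using \<delta> gap by (simp add: d_def)
  define a where "a = 1 - (1 + \<delta>) / p"
  have a: "0 < a" "a \<le> 1 - 1 / p"
    using p p1 \<delta> by (auto simp: a_def field_simps)
  note L1 = average_error_L1[OF f \<delta> p burn_in, of n]
  show i: "integrable M (\<lambda>\<omega>. mcmc_average X n m f \<omega>)" by (rule L1(1))
  show "(\<integral>\<omega>. \<bar>mcmc_average X n m f \<omega> - (\<integral>x. f x \<partial>\<pi>)\<bar> \<partial>M) \<le> 8 / N powr (1 - (1 + \<delta>) / p)"
  proof (cases "N < 1")
    case True
    \<comment> \<open>In this case the claimed bound is at least 8, while the L1 bound is at most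
      \<open>2 * 2 + 1\<close>.\<close>
    have "(\<Sum>j=1..n. exp (- d * real j)) \<le> (\<Sum>j=1..n. 1)"
      using d by (intro sum_mono) auto
    then have "\<delta> / (32 * real n) * (\<Sum>j=1..n. exp (- d * real j)) \<le> \<delta> / (32 * real n) * n"
      using \<delta> by (intro mult_left_mono) auto
    also have "\<dots> \<le> 1" using \<delta> n by simp
    finally have "(\<integral>\<omega>. \<bar>mcmc_average X n m f \<omega> - (\<integral>x. f x \<partial>\<pi>)\<bar> \<partial>M) \<le> 8"
      using L1(2) Lp_ball_integrable(2)[OF f p1(1)] by (simp add: d_def)
    also have "8 \<le> 8 / N powr a"
      using True N a powr_mono2[of a N 1] by (simp add: field_simps)
    finally show ?thesis by (simp add: a_def)
  next
    case False
    then have N1: "1 \<le> N" by simp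
    \<comment> \<open>This level balances the two parts: \<open>sqrt (T powr (2 - p) / N)\<close>
      and \<open>T powr (1 - p)\<close> both equal \<open>N powr (1 / p - 1)\<close>.\<close>
    define T where "T = N powr (1 / p)"
    have T: "0 < T" using N by (simp add: T_def)
    define q where "q = 1 / p - 1"
    define g where "g x = trunc T (f x)" for x
    define b where "b x = f x - trunc T (f x)" for x
    note tr = Lp_ball_trunc[OF f T p1(1) p(2)]
    have [measurable]: "g \<in> borel_measurable borel" "b \<in> borel_measurable borel"
      unfolding g_def b_def by measurable
    have Tq: "T powr (1 - p) = N powr q"
      using p1 by (simp add: T_def powr_powr q_def field_simps)
    have T2: "T powr (2 - p) = N powr (2 * q + 1)"
      using p1 by (simp add: T_def powr_powr q_def field_simps)
    have g: "\<bar>g x\<bar> \<le> T" for x using abs_trunc_le[of T] T by (simp add: g_def)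
    have ig: "integrable \<pi> g" by (rule integrable_pi[OF _ g]) measurable
    have V: "(\<integral>x. (g x)\<^sup>2 \<partial>\<pi>) \<le> N powr (2 * q + 1)"
      using tr(1) by (simp add: g_def T2)
    have b_le: "\<bar>b x\<bar> powr p \<le> \<bar>f x\<bar> powr p" for x
      by (simp add: b_def trunc_def)
    have b: "b \<in> Lp_ball p"
    proof -
      have ip: "integrable \<pi> (\<lambda>x. \<bar>f x\<bar> powr p)" "(\<integral>x. \<bar>f x\<bar> powr p \<partial>\<pi>) \<le> 1"
        using f by (auto simp: Lp_ball_def)
      have ib: "integrable \<pi> (\<lambda>x. \<bar>b x\<bar> powr p)"
        by (rule Bochner_Integration.integrable_bound[OF ip(1)]) (use b_le in auto)
      have "(\<integral>x. \<bar>b x\<bar> powr p \<partial>\<pi>) \<le> (\<integral>x. \<bar>f x\<bar> powr p \<partial>\<pi>)"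
        using ib ip b_le by (intro integral_mono) auto
      with ip ib show ?thesis by (simp add: Lp_ball_def)
    qed
    \<comment> \<open>As \<open>\<delta> \<le> 1\<close>, the burn-in at the slower rate
      \<open>d\<close> implies the one at the full rate that the L2 bound requires.\<close>
    have "exp (- gap \<pi> K * m) \<le> exp (- d * m)"
      using \<delta> gap by (auto simp: d_def intro!: mult_right_mono mult_left_le_one_le)
    from mult_left_mono[OF this H_nonneg] have "H * exp (- gap \<pi> K * m) \<le> 1 / 64"
      using burn_in \<delta> by (simp add: d_def)
    note L2 = average_error_L2[OF _ g V gap n this, folded N_def]
    note L1b = average_error_L1[OF b \<delta> p burn_in, of n]
    \<comment> \<open>The non-stationary term has the smaller exponent \<open>2 * q - 1 / 2\<close>,
      so \<open>3 + 1 / 4 \<le> 4\<close> suffices, and 4 has the convenient root 2.\<close>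
    have "3 * N powr (2 * q + 1) / N + T * sqrt (N powr (2 * q + 1)) / (4 * N\<^sup>2) \<le> 4 * N powr (2 * q)"
    proof -
      have "N powr (2 * q + 1) / N = N powr (2 * q)"
        using N by (simp add: powr_add)
      moreover have "T * sqrt (N powr (2 * q + 1)) / N\<^sup>2 = N powr (2 * q - 1 / 2)"
      proof -
        have "T * sqrt (N powr (2 * q + 1)) = N powr (1 / p + (2 * q + 1) / 2)"
          by (simp only: T_def powr_half_sqrt[symmetric] powr_ge_zero powr_powr powr_add[symmetric]) simp
        also have "\<dots> / N\<^sup>2 = N powr (1 / p + (2 * q + 1) / 2 - 2)"
          using N by (simp add: powr_diff powr_numeral)
        finally show ?thesis by (simp add: q_def field_simps)
      qed
      moreover have "N powr (2 * q - 1 / 2) \<le> N powr (2 * q)"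
        using N1 by (intro powr_mono) auto
      moreover have "0 \<le> N powr (2 * q)" by simp
      moreover have "3 * N powr (2 * q + 1) / N + T * sqrt (N powr (2 * q + 1)) / (4 * N\<^sup>2)
          = 3 * (N powr (2 * q + 1) / N) + T * sqrt (N powr (2 * q + 1)) / N\<^sup>2 / 4"
        by simp
      ultimately show ?thesis by linarith
    qed
    moreover have "(N powr q)\<^sup>2 = N powr (2 * q)"
      by (simp add: power2_eq_square powr_add[symmetric])
    ultimately have "sqrt (3 * N powr (2 * q + 1) / N + T * sqrt (N powr (2 * q + 1)) / (4 * N\<^sup>2)) \<le> 2 * N powr q"
      by (intro real_le_lsqrt) (auto simp: power_mult_distrib)
    with L2(2) have E1: "(\<integral>\<omega>. \<bar>mcmc_average X n m g \<omega> - (\<integral>x. g x \<partial>\<pi>)\<bar> \<partial>M) \<le> 2 * N powr q"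
      by simp
    \<comment> \<open>The \<open>\<delta>\<close> gained from the burn-in cancels the one in
      \<open>d = \<delta> * gap \<pi> K\<close>; this is the purpose of \<open>64 / \<delta>\<close>
      inside the logarithm.\<close>
    have "\<delta> / (32 * real n) * (\<Sum>j=1..n. exp (- d * real j)) \<le> \<delta> / (32 * real n) * (1 / d)"
      using d \<delta> by (intro mult_left_mono sum_exp_le) auto
    also have "\<dots> = N powr (-1) / 32"
      using \<delta> N by (simp add: d_def N_def powr_minus_divide field_simps)
    also have "\<dots> \<le> N powr q / 32"
      using N1 p1 by (intro divide_right_mono powr_mono) (auto simp: q_def)
    finally have "\<delta> / (32 * real n) * (\<Sum>j=1..n. exp (- d * real j)) \<le> N powr q / 32" .
    moreover have "(\<integral>x. \<bar>b x\<bar> \<partial>\<pi>) \<le> N powr q"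
      using tr(3) by (simp add: b_def Tq)
    ultimately have E2: "(\<integral>\<omega>. \<bar>mcmc_average X n m b \<omega> - (\<integral>x. b x \<partial>\<pi>)\<bar> \<partial>M) \<le> 2 * N powr q + N powr q / 32"
      using L1b(2) unfolding d_def by linarith
    have "mcmc_average X n m f \<omega> - (\<integral>x. f x \<partial>\<pi>)
        = (mcmc_average X n m g \<omega> - (\<integral>x. g x \<partial>\<pi>)) + (mcmc_average X n m b \<omega> - (\<integral>x. b x \<partial>\<pi>))" for \<omega>
    proof -
      have "(\<integral>x. f x \<partial>\<pi>) = (\<integral>x. g x + b x \<partial>\<pi>)" by (simp add: g_def b_def)
      also have "\<dots> = (\<integral>x. g x \<partial>\<pi>) + (\<integral>x. b x \<partial>\<pi>)"
        using ig Lp_ball_integrable(1)[OF b p1(1)] by simp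
      finally show ?thesis
        by (simp add: mcmc_average_def g_def b_def sum_subtractf algebra_simps)
    qed
    then have "(\<integral>\<omega>. \<bar>mcmc_average X n m f \<omega> - (\<integral>x. f x \<partial>\<pi>)\<bar> \<partial>M)
      \<le> (\<integral>\<omega>. \<bar>mcmc_average X n m g \<omega> - (\<integral>x. g x \<partial>\<pi>)\<bar> + \<bar>mcmc_average X n m b \<omega> - (\<integral>x. b x \<partial>\<pi>)\<bar> \<partial>M)"
      using i L2(1) L1b(1) by (intro integral_mono) (auto intro: abs_triangle_ineq)
    also have "\<dots> = (\<integral>\<omega>. \<bar>mcmc_average X n m g \<omega> - (\<integral>x. g x \<partial>\<pi>)\<bar> \<partial>M)
        + (\<integral>\<omega>. \<bar>mcmc_average X n m b \<omega> - (\<integral>x. b x \<partial>\<pi>)\<bar> \<partial>M)"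
      using L2(1) L1b(1) by simp
    also have "\<dots> \<le> 8 * N powr q"
      using E1 E2 powr_ge_zero[of N q] by linarith
    \<comment> \<open>The exponent reached exceeds the claimed one by \<open>\<delta> / p\<close>,
      which for \<open>1 \<le> N\<close> may be given away.\<close>
    also have "\<dots> \<le> 8 * N powr (- a)"
      using N1 a by (intro mult_left_mono powr_mono) (auto simp: q_def)
    also have "\<dots> = 8 / N powr a"
      by (simp add: powr_minus_divide)
    finally show ?thesis by (simp add: a_def)
  qed
qed

end

section \<open>From the extended-valued hypotheses to real inequalities\<close>

lemma burn_in_bound:
  fixes H d e :: real
  assumes H: "0 \<le> H" and "0 < d" "0 < e"
    and m: "elog (ennreal (64 / d) * ennreal H) / ereal e \<le> ereal (real m)"
  shows "H * exp (- e * m) \<le> d / 64"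
\<comment> \<open>For \<open>H = 0\<close> the logarithm is minus infinity and the hypothesis says
  nothing about \<open>m\<close>, but the claim is trivial.\<close>
proof (cases "H = 0")
  case False
  then have H: "0 < H" using H by simp
  have "ennreal (64 / d) * ennreal H = ennreal (64 / d * H)"
    using assms(2) H by (intro ennreal_mult[symmetric]) auto
  moreover have "0 < 64 / d * H" using assms(2) H by simp
  ultimately have "elog (ennreal (64 / d) * ennreal H) = ereal (ln (64 / d * H))"
    using assms(2) H by (simp add: elog_def)
  with m assms(3) have "ln (64 / d * H) \<le> e * m"
    by (simp add: field_simps)
  then have "64 / d * H \<le> exp (e * m)"
    using \<open>0 < 64 / d * H\<close> by (metis exp_le_cancel_iff exp_ln)
  then show ?thesis
    using assms(2) by (simp add: exp_minus field_simps)
qed (use assms in simp)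

lemma elog_finite_factor:
  assumes "elog (ennreal c * x) / ereal e \<le> ereal r" "0 < c" "0 < e"
  shows "x < \<infinity>"
proof (rule ccontr)
  assume "\<not> x < \<infinity>"
  then have "x = \<infinity>" by (metis infinity_ennreal_def top.not_eq_extremum)
  then have "elog (ennreal c * x) = \<infinity>"
    using assms(2) by (simp add: elog_def ennreal_mult_top)
  then show False using assms(1,3) by simp
qed

text \<open>The essential supremum is itself an almost sure bound; finiteness excludes the default
  value of \<open>enn2real\<close> at infinity.\<close>

lemma (in prob_space) Lp_infinity_norm_AE:
  assumes "Lp_norm \<infinity> M u < \<infinity>"
  shows "AE x in M. \<bar>u x\<bar> \<le> enn2real (Lp_norm \<infinity> M u)"
proof -
  have "AE x in M. ennreal \<bar>u x\<bar> \<le> Lp_norm \<infinity> M u"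
    unfolding Lp_norm_def by (simp add: esssup_AE)
  then show ?thesis
  proof (rule eventually_mono)
    fix x assume "ennreal \<bar>u x\<bar> \<le> Lp_norm \<infinity> M u"
    then show "\<bar>u x\<bar> \<le> enn2real (Lp_norm \<infinity> M u)"
      using assms enn2real_mono[of "ennreal \<bar>u x\<bar>" "Lp_norm \<infinity> M u"] by simp
  qed
qed

section \<open>The error bound for functions in L_p, by rescaling to the unit ball\<close>

theorem theorem2:
  fixes \<pi> \<nu> :: "'a::metric_space measure"
    and K :: "'a \<Rightarrow> 'a measure"
    and M :: "'w measure"
    and X :: "nat \<Rightarrow> 'w \<Rightarrow> 'a"
    and h f :: "'a \<Rightarrow> real"
    and \<delta> p :: real
    and n n0 :: nat
  assumes pi: "\<pi> \<in> space (prob_algebra borel)"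
    and K: "K \<in> borel \<rightarrow>\<^sub>M prob_algebra borel"
    and stationary: "stationary \<pi> K"
    and nu: "\<nu> \<in> space (prob_algebra borel)"
    and chain: "markov_chain M X K \<nu>"
    and gap: "gap \<pi> K > 0"
    and h: "h \<in> borel_measurable borel" "AE x in \<pi>. 0 \<le> h x"
    and density: "\<nu> = density \<pi> (\<lambda>x. ennreal (h x))"
    and h_bounded: "Lp_norm \<infinity> \<pi> h < \<infinity>"
    and delta: "0 < \<delta>" "\<delta> \<le> 1"
    and p: "1 + \<delta> < p" "p \<le> 2"
    and n0: "ereal (real n0) \<ge>
      elog (ennreal (64 / \<delta>) * Lp_norm \<infinity> \<pi> (\<lambda>x. h x - 1)) / ereal (\<delta> * gap \<pi> K)"
    and n: "n \<ge> 1"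
    and f: "f \<in> Lp_space (ereal p) \<pi>"
  shows "e1 M X \<pi> n n0 f \<le>
    8 * Lp_norm (ereal p) \<pi> f / ennreal ((real n * gap \<pi> K) powr (1 - (1 + \<delta>) / p)) +
    8 * Lp_norm (ereal p) \<pi> f / ennreal ((real n * gap \<pi> K) powr (2 - 2 * (1 + \<delta>) / p))"
proof -
  interpret \<pi>: stationary_kernel \<pi> K
    using pi K stationary by unfold_locales
  define H where "H = enn2real (Lp_norm \<infinity> \<pi> (\<lambda>x. h x - 1))"
  \<comment> \<open>An infinite norm would make the quotient bounding \<open>n0\<close> from below
    infinite.\<close>
  have fin: "Lp_norm \<infinity> \<pi> (\<lambda>x. h x - 1) < \<infinity>"
    using elog_finite_factor[OF n0] delta gap by simp
  interpret stationary_kernel_chain \<pi> K M X \<nu> h H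
    using chain h density \<pi>.Lp_infinity_norm_AE[OF fin]
    by unfold_locales (auto simp: H_def)
  have burn_in: "H * exp (- (\<delta> * gap \<pi> K) * n0) \<le> \<delta> / 64"
    using n0 fin delta gap by (intro burn_in_bound) (auto simp: H_def)
  have p0: "0 < p" using p delta by simp
  define I where "I = (\<integral>\<^sup>+x. ennreal (\<bar>f x\<bar> powr p) \<partial>\<pi>)"
  have fm: "f \<in> borel_measurable \<pi>" and "Lp_norm (ereal p) \<pi> f < \<infinity>"
    using f by (auto simp: Lp_space_def)
  then have I: "I \<noteq> \<infinity>" and norm: "Lp_norm (ereal p) \<pi> f = ennreal (enn2real I powr (1 / p))"
    by (auto simp: Lp_norm_def Let_def I_def split: if_splits)
  have fb [measurable]: "f \<in> borel_measurable borel"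
    using fm by simp
  define J where "J = enn2real I"
  define F where "F = J powr (1 / p)"
  have "integrable \<pi> (\<lambda>x. \<bar>f x\<bar> powr p)"
    by (rule integrableI_bounded) (use I in \<open>auto simp: I_def top.not_eq_extremum\<close>)
  moreover have J: "J = (\<integral>x. \<bar>f x\<bar> powr p \<partial>\<pi>)"
    using calculation unfolding J_def I_def by (subst nn_integral_eq_integral) auto
  ultimately have ip: "integrable \<pi> (\<lambda>x. \<bar>f x\<bar> powr p)" "J = (\<integral>x. \<bar>f x\<bar> powr p \<partial>\<pi>)" by auto
  have J0: "0 \<le> J" and F0: "0 \<le> F" by (auto simp: J_def F_def)
  have JF: "J = F powr p"
    using J0 p0 by (simp add: F_def powr_powr)
  define y where "y = (n * gap \<pi> K) powr (1 - (1 + \<delta>) / p)"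
  define z where "z = (n * gap \<pi> K) powr (2 - 2 * (1 + \<delta>) / p)"
  have y: "0 < y" using gap n by (simp add: y_def)
  \<comment> \<open>The strict inequality keeps the divisor positive even when \<open>f\<close>
    vanishes almost everywhere; \<open>c\<close> is sent to \<open>F\<close> afterwards.\<close>
  have scaled: "e1 M X \<pi> n n0 f \<le> ennreal (c * (8 / y))" if c: "F < c" for c
  proof -
    have c0: "0 < c" using c F0 by simp
    define g where "g x = f x / c" for x
    have [measurable]: "g \<in> borel_measurable borel" unfolding g_def by measurable
    have gp: "\<bar>g x\<bar> powr p = \<bar>f x\<bar> powr p / c powr p" for x
      using c0 by (simp add: g_def powr_divide)
    have "J \<le> c powr p"
      unfolding JF using c F0 p0 by (intro powr_mono2) auto
    then have "g \<in> Lp_ball p"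
      using ip c0 by (simp add: Lp_ball_def gp)
    note avg = average_error[OF this delta p gap n burn_in]
    have "mcmc_average X n n0 f \<omega> - (\<integral>x. f x \<partial>\<pi>) = c * (mcmc_average X n n0 g \<omega> - (\<integral>x. g x \<partial>\<pi>))" for \<omega>
      using c0 by (simp add: mcmc_average_def g_def sum_divide_distrib[symmetric] field_simps)
    then have "e1 M X \<pi> n n0 f = (\<integral>\<^sup>+\<omega>. ennreal (c * \<bar>mcmc_average X n n0 g \<omega> - (\<integral>x. g x \<partial>\<pi>)\<bar>) \<partial>M)"
      using c0 by (simp add: e1_def abs_mult)
    also have "\<dots> = ennreal (\<integral>\<omega>. c * \<bar>mcmc_average X n n0 g \<omega> - (\<integral>x. g x \<partial>\<pi>)\<bar> \<partial>M)"
      using avg(1) c0 by (intro nn_integral_eq_integral) auto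
    also have "\<dots> \<le> ennreal (c * (8 / y))"
      using mult_left_mono[OF avg(2), of c] c0 by (intro ennreal_leI) (simp add: y_def)
    finally show ?thesis .
  qed
  have "e1 M X \<pi> n n0 f \<le> ennreal (F * (8 / y))"
  proof (rule ennreal_le_epsilon)
    fix e :: real assume e: "0 < e"
    \<comment> \<open>The increment of \<open>c\<close> is chosen so that its contribution is
      exactly \<open>e\<close>.\<close>
    have "e1 M X \<pi> n n0 f \<le> ennreal ((F + e * (y / 8)) * (8 / y))"
      using e y by (intro scaled) auto
    also have "\<dots> = ennreal (F * (8 / y)) + ennreal e"
      using e y F0 by (simp add: distrib_right add_divide_distrib ennreal_plus[symmetric] del: ennreal_plus)
    finally show "e1 M X \<pi> n n0 f \<le> ennreal (F * (8 / y)) + ennreal e" .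
  qed
  also have "ennreal (F * (8 / y)) = 8 * Lp_norm (ereal p) \<pi> f / ennreal y"
  proof -
    have "8 * ennreal F / ennreal y = ennreal (8 * F) / ennreal y"
      using F0 by (simp add: ennreal_mult)
    also have "\<dots> = ennreal (F * (8 / y))"
      using F0 y by (simp add: divide_ennreal mult.commute)
    finally show ?thesis by (simp add: norm F_def J_def)
  qed
  also have "\<dots> \<le> 8 * Lp_norm (ereal p) \<pi> f / ennreal y + 8 * Lp_norm (ereal p) \<pi> f / ennreal z"
    by simp
  finally show ?thesis by (simp only: y_def z_def)
qed

end
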